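(* Let $0\le M\le N$ be integers, $a=(a_1,\dots,a_M)$ and $b=(b_0,b_1,\dots,b_N)$ with all entries positive, and let $\kappa>0$. Then $$\beta_{M,N}(\kappa a,\kappa b)^{\kappa}\ \overset{\text{in law}}{=}\ \beta_{M,N}(a,b).$$
   Context: Barnes multiple log-gamma function: for $a=(a_1,\dots,a_M)$, $a_j>0$, $\zeta_M(s,w\,|\,a)=\sum_{k_1,\dots,k_M=0}^\infty(w+k_1a_1+\cdots+k_Ma_M)^{-s}$ for $\Re(s)>M$, $\Re(w)>0$, continued meromorphically in $s$; $L_M(w\,|\,a)=\partial_s\zeta_M(s,w\,|\,a)|_{s=0}$, continued analytically to $w\in\mathbb{C}\setminus(-\infty,0]$; $L_0(w)=-\log w$. Operator $\mathcal{S}_N$: $(\mathcal{S}_Nh)(q\,|\,b)=\sum_{J\subseteq\{1,\dots,N\}}(-1)^{|J|}h\bigl(q+b_0+\sum_{j\in J}b_j\bigr)$. Barnes beta distribution: for $M\le N$ the function $\eta_{M,N}(q\,|\,a,b)=\exp\bigl((\mathcal{S}_NL_M)(q\,|\,a,b)-(\mathcal{S}_NL_M)(0\,|\,a,b)\bigr)$ (with $h=L_M(\cdot\,|\,a)$) is known to be the Mellin transform of a unique probability distribution on $(0,1]$; a random variable with this law is denoted $\beta_{M,N}(a,b)$, i.e. $\mathbf{E}[\beta_{M,N}(a,b)^q]=\eta_{M,N}(q\,|\,a,b)$ for $\Re(q)>-b_0$. Here $\kappa a=(\kappa a_1,\dots,\kappa a_M)$ and $\kappa b=(\kappa b_0,\dots,\kappa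 b_N)$. *)

theory Defs
  imports "HOL-Complex_Analysis.Complex_Analysis" "HOL-Probability.Probability"
begin

text \<open>
  Parameter tuples \<open>a = (a\<^sub>1, \<dots>, a\<^sub>M)\<close> and \<open>b = (b\<^sub>0, b\<^sub>1, \<dots>, b\<^sub>N)\<close> are functions on \<open>nat\<close> of which only
  the values at \<open>{1..M}\<close> and \<open>{0..N}\<close> are used; a multi-index is an element of
  \<open>{1..M} \<rightarrow>\<^sub>E UNIV\<close>.  For \<open>M = 0\<close> there is exactly one multi-index, so the series below is
  the single term \<open>w powr (-s)\<close>.
\<close>

definition barnes_zeta_series :: "nat \<Rightarrow> (nat \<Rightarrow> real) \<Rightarrow> complex \<Rightarrow> complex \<Rightarrow> complex" where
  "barnes_zeta_series M a s w =
     (\<Sum>\<^sub>\<infinity>k\<in>{1..M} \<rightarrow>\<^sub>E (UNIV :: nat set).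
        (w + of_real (\<Sum>j=1..M. real (k j) * a j)) powr (- s))"

text \<open>
  The meromorphic continuation in \<open>s\<close> for \<open>Re w > 0\<close>.  The ``nicely meromorphic'' representative
  (removable singularities removed, value 0 at poles) makes the continuation unique as a function;
  see \<open>barnes_zeta_eqI\<close>.
\<close>

definition barnes_zeta :: "nat \<Rightarrow> (nat \<Rightarrow> real) \<Rightarrow> complex \<Rightarrow> complex \<Rightarrow> complex" where
  "barnes_zeta M a s w =
     (THE F. F nicely_meromorphic_on UNIV \<and>
             (\<forall>z. Re z > real M \<longrightarrow> F z = barnes_zeta_series M a z w)) s"

text \<open>
  The derivative at \<open>s = 0\<close> defines the function on the right half-plane; elsewhere on the slit
  plane it is the analytic extension.  Values on \<open>(-\<infinity>, 0]\<close> carry no meaning.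
\<close>

definition barnes_log_gamma :: "nat \<Rightarrow> (nat \<Rightarrow> real) \<Rightarrow> complex \<Rightarrow> complex" where
  "barnes_log_gamma M a w =
     (if Re w > 0 then deriv (\<lambda>s. barnes_zeta M a s w) 0
      else (SOME L. L holomorphic_on (- \<real>\<^sub>\<le>\<^sub>0) \<and>
                    (\<forall>z. Re z > 0 \<longrightarrow> L z = deriv (\<lambda>s. barnes_zeta M a s z) 0)) w)"

definition barnes_S :: "nat \<Rightarrow> (nat \<Rightarrow> real) \<Rightarrow> (complex \<Rightarrow> complex) \<Rightarrow> complex \<Rightarrow> complex" where
  "barnes_S N b h q =
     (\<Sum>J\<in>Pow {1..N}. (-1) ^ card J * h (q + of_real (b 0) + of_real (\<Sum>j\<in>J. b j)))"

definition barnes_eta ::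
    "nat \<Rightarrow> nat \<Rightarrow> (nat \<Rightarrow> real) \<Rightarrow> (nat \<Rightarrow> real) \<Rightarrow> complex \<Rightarrow> complex" where
  "barnes_eta M N a b q =
     exp (barnes_S N b (barnes_log_gamma M a) q - barnes_S N b (barnes_log_gamma M a) 0)"

text \<open>
  \<open>\<mu>\<close> is the law of \<open>\<beta>\<^sub>M\<^sub>,\<^sub>N(a, b)\<close>: a probability distribution on \<open>(0, 1]\<close> with Mellin transform
  \<open>\<eta>\<^sub>M\<^sub>,\<^sub>N(\<cdot> | a, b)\<close>; the moments are required to exist as absolutely convergent integrals.
\<close>

definition barnes_beta_law ::
    "nat \<Rightarrow> nat \<Rightarrow> (nat \<Rightarrow> real) \<Rightarrow> (nat \<Rightarrow> real) \<Rightarrow> real measure \<Rightarrow> bool" where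
  "barnes_beta_law M N a b \<mu> \<longleftrightarrow>
     prob_space \<mu> \<and> sets \<mu> = sets borel \<and> (AE x in \<mu>. x \<in> {0<..1}) \<and>
     (\<forall>q. Re q > - b 0 \<longrightarrow>
        has_bochner_integral \<mu> (\<lambda>x. complex_of_real x powr q) (barnes_eta M N a b q))"

lemma nicely_meromorphic_eqI:
  assumes F: "F nicely_meromorphic_on UNIV" and G: "G nicely_meromorphic_on UNIV"
    and eq: "\<And>z. Re z > c \<Longrightarrow> F z = G z"
  shows "F = G"
proof
  fix z
  let ?H = "\<lambda>z. F z - G z"
  have mF: "F meromorphic_on UNIV" and mG: "G meromorphic_on UNIV"
    using F G by (auto simp: nicely_meromorphic_on_def)
  have "?H meromorphic_on UNIV"
    using mF mG by (rule meromorphic_on_diff)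
  then have "(\<forall>\<^sub>\<approx>x\<in>UNIV. ?H x = 0) \<or> (\<forall>\<^sub>\<approx>x\<in>UNIV. ?H x \<noteq> 0)"
    by (intro meromorphic_imp_constant_or_avoid) auto
  moreover have "\<not> (\<forall>\<^sub>\<approx>x\<in>UNIV. ?H x \<noteq> 0)"
  proof
    assume "\<forall>\<^sub>\<approx>x\<in>UNIV. ?H x \<noteq> 0"
    then have "eventually (\<lambda>x. ?H x \<noteq> 0) (at (of_real (c + 1)))"
      by (auto simp: eventually_cosparse_open_eq)
    moreover have "eventually (\<lambda>x. x \<in> {x. Re x > c}) (at (of_real (c + 1)))"
      by (intro eventually_at_in_open') (auto simp: open_halfspace_Re_gt)
    ultimately have "eventually (\<lambda>x. False) (at (complex_of_real (c + 1)))"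
      by eventually_elim (use eq in auto)
    then show False by simp
  qed
  ultimately have ev: "eventually (\<lambda>x. F x = G x) (at z)"
    by (auto simp: eventually_cosparse_open_eq)
  have pole: "is_pole F z \<longleftrightarrow> is_pole G z"
    by (rule is_pole_cong[OF ev refl])
  show "F z = G z"
  proof (cases "is_pole F z")
    case True
    moreover have "\<not> (f \<midarrow>z\<rightarrow> f z)" if "is_pole f z" for f :: "complex \<Rightarrow> complex"
      using that not_tendsto_and_filterlim_at_infinity[of "at z" f]
      by (auto simp: is_pole_def)
    ultimately have "F z = 0" "G z = 0"
      using F G pole unfolding nicely_meromorphic_on_def by blast+
    then show ?thesis by simp
  next
    case False
    then have "F \<midarrow>z\<rightarrow> F z" "G \<midarrow>z\<rightarrow> G z"
      using F G pole by (auto simp: nicely_meromorphic_on_def)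
    then show ?thesis
      using ev LIM_unique tendsto_cong by metis
  qed
qed

lemma barnes_zeta_eqI:
  assumes "F nicely_meromorphic_on UNIV"
    and "\<And>z. Re z > real M \<Longrightarrow> F z = barnes_zeta_series M a z w"
  shows "barnes_zeta M a s w = F s"
proof -
  have "(THE F. F nicely_meromorphic_on UNIV \<and>
          (\<forall>z. Re z > real M \<longrightarrow> F z = barnes_zeta_series M a z w)) = F"
    by (rule the_equality) (use assms in \<open>auto intro!: nicely_meromorphic_eqI[of _ F "real M"]\<close>)
  then show ?thesis by (simp add: barnes_zeta_def)
qed

text \<open>The convention \<open>L\<^sub>0(w) = -log w\<close> is an instance of the general definition.\<close>

lemma deriv_barnes_zeta_0:
  assumes "w \<noteq> 0"
  shows "deriv (\<lambda>s. barnes_zeta 0 a s w) 0 = - Ln w"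
proof -
  have "(\<lambda>s. w powr (- s)) nicely_meromorphic_on UNIV"
    by (intro analytic_on_imp_nicely_meromorphic_on)
       (use assms in \<open>auto simp: analytic_on_open intro!: holomorphic_intros\<close>)
  then have "barnes_zeta 0 a s w = w powr (- s)" for s
    by (rule barnes_zeta_eqI) (simp add: barnes_zeta_series_def)
  moreover have "((\<lambda>s. w powr (- s)) has_field_derivative - Ln w) (at 0)"
    using assms by (auto simp: powr_def intro!: derivative_eq_intros)
  ultimately show ?thesis
    by (simp add: DERIV_imp_deriv)
qed

lemma barnes_log_gamma_0:
  assumes "w \<notin> \<real>\<^sub>\<le>\<^sub>0"
  shows "barnes_log_gamma 0 a w = - Ln w"
proof -
  let ?P = "\<lambda>L. L holomorphic_on (- \<real>\<^sub>\<le>\<^sub>0) \<and>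
                (\<forall>z. Re z > 0 \<longrightarrow> L z = deriv (\<lambda>s. barnes_zeta 0 a s z) 0)"
  have P0: "?P (\<lambda>w. - Ln w)"
    by (intro conjI allI impI)
       (auto intro!: holomorphic_intros simp: deriv_barnes_zeta_0 intro: deriv_barnes_zeta_0[symmetric])
  define L where "L = (SOME L. ?P L)"
  have L: "?P L"
    unfolding L_def by (rule someI[of ?P, OF P0])
  have "L w = - Ln w"
  proof (rule analytic_continuation_open[of "{z. Re z > 0}" "- \<real>\<^sub>\<le>\<^sub>0" L "\<lambda>z. - Ln z"])
    show "connected (- \<real>\<^sub>\<le>\<^sub>0 :: complex set)"
    proof -
      have "(\<real>\<^sub>\<le>\<^sub>0 :: complex set) = complex_of_real ` {..0}"
        by (auto simp: nonpos_Reals_def)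
      then show ?thesis
        using starlike_imp_connected[OF starlike_slotted_complex_plane_left[of 0]] by simp
    qed
    show "{z. Re z > 0} \<noteq> {}"
      by (auto intro!: exI[of _ 1])
    show "L z = - Ln z" if "z \<in> {z. Re z > 0}" for z
    proof -
      from that have "z \<noteq> 0" by auto
      with L that show ?thesis by (simp add: deriv_barnes_zeta_0)
    qed
  qed (use L P0 assms in \<open>auto simp: open_halfspace_Re_gt complex_nonpos_Reals_iff
          intro: closed_nonpos_Reals_complex\<close>)
  moreover have "w \<noteq> 0"
    using assms by auto
  ultimately show ?thesis
    using deriv_barnes_zeta_0[of w a]
    by (auto simp: barnes_log_gamma_def L_def)
qed

end

theory Submission
  imports Defs
begin

text \<open>
  Since \<open>\<zeta>\<^sub>M(s, \<kappa> w | \<kappa> a) = \<kappa>\<^sup>-\<^sup>s \<zeta>\<^sub>M(s, w | a)\<close>, differentiating at \<open>s = 0\<close> shows that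
  \<open>L\<^sub>M(\<kappa> w | \<kappa> a)\<close> and \<open>L\<^sub>M(w | a)\<close> differ by \<open>log \<kappa> \<cdot> \<zeta>\<^sub>M(0, w | a)\<close>, a polynomial in \<open>w\<close> of degree at
  most \<open>M\<close>.  As \<open>M \<le> N\<close>, the \<open>N\<close>-fold difference operator \<open>S\<^sub>N\<close> maps this polynomial to a constant,
  which cancels in \<open>\<eta>\<close>, so the two laws have the same Mellin transform on the imaginary axis, that is,
  their logarithms have the same characteristic function.

  The meromorphic continuation and the polynomiality come from one recursion.  Taylor's formula for
  \<open>\<zeta>\<^sub>M\<^sub>+\<^sub>1(s, w + \<alpha>)\<close> in powers of \<open>\<alpha> = a\<^sub>M\<^sub>+\<^sub>1\<close>, combined with
  \<open>\<zeta>\<^sub>M\<^sub>+\<^sub>1(s, w + \<alpha>) = \<zeta>\<^sub>M\<^sub>+\<^sub>1(s, w) - \<zeta>\<^sub>M(s, w)\<close>, expresses \<open>s \<alpha> \<zeta>\<^sub>M\<^sub>+\<^sub>1(s + 1, w)\<close> through \<open>\<zeta>\<^sub>M(s, w)\<close>, the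
  values \<open>\<zeta>\<^sub>M\<^sub>+\<^sub>1(s + m, w)\<close> with \<open>m \<ge> 2\<close>, and a remainder that is holomorphic on a half-plane as large as
  desired.  Multiplying by \<open>(s - 1) \<dots> (s - M)\<close> clears all poles.
\<close>

section \<open>Multiple series and their holomorphy\<close>

abbreviation multi_indices :: "nat \<Rightarrow> (nat \<Rightarrow> nat) set" where
  "multi_indices M \<equiv> {1..M} \<rightarrow>\<^sub>E UNIV"

definition lin_comb :: "nat \<Rightarrow> (nat \<Rightarrow> real) \<Rightarrow> (nat \<Rightarrow> nat) \<Rightarrow> real" where
  "lin_comb M a k = (\<Sum>j=1..M. real (k j) * a j)"

text \<open>The argument of \<open>z\<close> is at most \<open>pi\<close> in absolute value, so its
  effect is bounded by a factor free of \<open>z\<close>. This makes the bound uniform over the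
  terms of a multiple series.\<close>

lemma norm_powr_uminus_le:
  fixes z s :: complex
  shows "norm (z powr (- s)) \<le> exp (pi * \<bar>Im s\<bar>) * norm z powr (- Re s)"
proof -
  have "Im s * Arg z \<le> \<bar>Im s\<bar> * \<bar>Arg z\<bar>"
    by (metis abs_ge_self abs_mult)
  also have "\<dots> \<le> \<bar>Im s\<bar> * pi"
    using Arg_bounded[of z] by (intro mult_left_mono) auto
  finally have "exp (Im s * Arg z) \<le> exp (pi * \<bar>Im s\<bar>)"
    by (simp add: mult.commute)
  then show ?thesis
    by (simp add: norm_powr_complex mult.commute mult_right_mono)
qed

text \<open>A finite set of multi-indices lies in a box, and over a box the sum of products is a
  product of partial sums, each at most \<open>suminf h\<close>.\<close>

lemma summable_on_prod_PiE:
  fixes h :: "nat \<Rightarrow> real"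
  assumes "finite A" and "summable h" and nonneg: "\<And>n. h n \<ge> 0"
  shows "(\<lambda>g. \<Prod>x\<in>A. h (g x)) summable_on (A \<rightarrow>\<^sub>E UNIV)"
proof (rule nonneg_bounded_partial_sums_imp_summable_on)
  show "\<forall>\<^sub>F F in finite_subsets_at_top (A \<rightarrow>\<^sub>E UNIV).
          (\<Sum>g\<in>F. \<Prod>x\<in>A. h (g x)) \<le> (suminf h) ^ card A"
  proof (rule eventually_finite_subsets_at_top_weakI)
    fix F assume F: "finite F" "F \<subseteq> A \<rightarrow>\<^sub>E (UNIV :: nat set)"
    \<comment> \<open>\<open>L\<close> exceeds every value that occurs; inserting 0 keeps
      \<open>Max\<close> meaningful when \<open>F\<close> or \<open>A\<close> is empty.\<close>
    define L where "L = Suc (Max (insert 0 ((\<lambda>(g, x). g x) ` (F \<times> A))))"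
    have L: "g x < L" if "g \<in> F" "x \<in> A" for g x
    proof -
      have "g x \<in> insert 0 ((\<lambda>(g, x). g x) ` (F \<times> A))"
        using that by force
      then show ?thesis
        unfolding L_def by (intro le_imp_less_Suc Max_ge) (use F(1) assms(1) in auto)
    qed
    have "(\<Sum>g\<in>F. \<Prod>x\<in>A. h (g x)) \<le> (\<Sum>g\<in>A \<rightarrow>\<^sub>E {..<L}. \<Prod>x\<in>A. h (g x))"
    proof (rule sum_mono2)
      show "F \<subseteq> A \<rightarrow>\<^sub>E {..<L}"
        using F(2) L by (auto simp: PiE_iff)
    qed (use assms in \<open>auto intro: finite_PiE prod_nonneg\<close>)
    also have "\<dots> = (\<Prod>x\<in>A. \<Sum>n<L. h n)"
      using assms(1) by (subst prod_sum_PiE) auto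
    also have "\<dots> \<le> (suminf h) ^ card A"
      using assms by (simp add: power_mono sum_nonneg sum_le_suminf)
    finally show "(\<Sum>g\<in>F. \<Prod>x\<in>A. h (g x)) \<le> (suminf h) ^ card A" .
  qed
qed (use nonneg in \<open>auto intro: prod_nonneg\<close>)

lemma lin_comb_nonneg:
  assumes "\<And>j. j \<in> {1..M} \<Longrightarrow> a j > 0"
  shows "lin_comb M a k \<ge> 0"
  unfolding lin_comb_def by (intro sum_nonneg mult_nonneg_nonneg) (use assms in \<open>auto simp: less_imp_le\<close>)

lemma norm_add_lin_comb_ge:
  assumes "\<And>j. j \<in> {1..M} \<Longrightarrow> a j > 0" and "Re w > 0"
  shows "norm (w + of_real (lin_comb M a k)) \<ge> Re w"
proof -
  have "Re w \<le> Re (w + of_real (lin_comb M a k))"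
    using lin_comb_nonneg[OF assms(1)] by simp
  also have "\<dots> \<le> norm (w + of_real (lin_comb M a k))"
    by (rule complex_Re_le_cmod)
  finally show ?thesis .
qed

text \<open>The exponent is shared equally among the \<open>M\<close> coordinates: the norm is at
  least \<open>c * (k j + 1)\<close> for each \<open>j\<close>, so the term is at most a product of
  one-dimensional terms with exponent \<open>\<sigma> / M > 1\<close>.\<close>

lemma summable_barnes:
  assumes a: "\<And>j. j \<in> {1..M} \<Longrightarrow> a j > 0" and w: "Re w > 0" and \<sigma>: "\<sigma> > real M"
  shows "(\<lambda>k. norm (w + of_real (lin_comb M a k)) powr (- \<sigma>)) summable_on multi_indices M"
proof (cases "M = 0")
  case True
  then show ?thesis by simp
next
  case False
  define c where "c = Min (insert (Re w) (a ` {1..M}))"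
  have c: "c > 0" "c \<le> Re w" "\<And>j. j \<in> {1..M} \<Longrightarrow> c \<le> a j"
    using a w unfolding c_def by (subst Min_gr_iff; auto) (intro Min_le; auto)+
  define h where "h n = (c * real (Suc n)) powr (- (\<sigma> / M))" for n
  have "summable h"
  proof -
    have "summable (\<lambda>n. real n powr (- (\<sigma> / M)))"
      using False \<sigma> by (simp add: summable_real_powr_iff)
    then have "summable (\<lambda>n. c powr (- (\<sigma> / M)) * real (Suc n) powr (- (\<sigma> / M)))"
      by (subst (asm) summable_Suc_iff[symmetric]) (rule summable_mult)
    moreover have "h = (\<lambda>n. c powr (- (\<sigma> / M)) * real (Suc n) powr (- (\<sigma> / M)))"
      using c(1) by (simp add: fun_eq_iff h_def powr_mult del: of_nat_Suc)
    ultimately show ?thesis by (simp only:)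
  qed
  then have "(\<lambda>k. \<Prod>j\<in>{1..M}. h (k j)) summable_on multi_indices M"
    by (intro summable_on_prod_PiE[OF _ \<open>summable h\<close>]) (auto simp: h_def)
  then show ?thesis
  proof (rule summable_on_comparison_test)
    fix k assume "k \<in> multi_indices M"
    let ?z = "norm (w + of_real (lin_comb M a k))"
    have le: "c * real (Suc (k j)) \<le> ?z" if j: "j \<in> {1..M}" for j
    proof -
      have "real (k j) * a j \<le> lin_comb M a k"
        unfolding lin_comb_def
        by (rule member_le_sum[where f = "\<lambda>j. real (k j) * a j"])
           (use j a in \<open>auto simp: less_imp_le\<close>)
      moreover have "real (k j) * c \<le> real (k j) * a j"
        using c(3)[OF j] by (intro mult_left_mono) auto
      ultimately have "c * real (Suc (k j)) \<le> Re (w + of_real (lin_comb M a k))"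
        using c by (simp add: algebra_simps)
      also have "\<dots> \<le> ?z"
        by (rule complex_Re_le_cmod)
      finally show ?thesis .
    qed
    have z: "?z > 0"
      by (rule order_less_le_trans[OF w norm_add_lin_comb_ge[OF a w]])
    have "?z powr (- \<sigma>) = (\<Prod>j\<in>{1..M}. ?z powr (- (\<sigma> / M)))"
      using z False by (simp add: powr_power)
    also have "\<dots> \<le> (\<Prod>j\<in>{1..M}. h (k j))"
      unfolding h_def
      by (intro prod_mono conjI powr_mono2') (use le c \<sigma> in \<open>auto\<close>)
    finally show "?z powr (- \<sigma>) \<le> (\<Prod>j\<in>{1..M}. h (k j))" .
  qed auto
qed

text \<open>Locally, the Weierstrass M-test makes the finite partial sums converge uniformly, and
  uniform limits of holomorphic functions are holomorphic.\<close>

lemma holomorphic_on_infsum: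
  fixes f :: "'k \<Rightarrow> complex \<Rightarrow> complex"
  assumes "open U" and "\<And>k. k \<in> K \<Longrightarrow> f k holomorphic_on U"
    and "\<And>z. z \<in> U \<Longrightarrow> \<exists>r>0. \<exists>B. cball z r \<subseteq> U \<and> B summable_on K \<and>
            (\<forall>k\<in>K. \<forall>s\<in>cball z r. norm (f k s) \<le> B k)"
  shows "(\<lambda>s. \<Sum>\<^sub>\<infinity>k\<in>K. f k s) holomorphic_on U"
proof -
  have "(\<lambda>s. \<Sum>\<^sub>\<infinity>k\<in>K. f k s) analytic_on {z}" if "z \<in> U" for z
  proof -
    note z = that
    obtain r B where r: "r > 0" "cball z r \<subseteq> U" "B summable_on K"
      and "\<forall>k\<in>K. \<forall>s\<in>cball z r. norm (f k s) \<le> B k"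
      using assms(3)[OF z] by blast
    then have le: "\<And>k s. k \<in> K \<Longrightarrow> s \<in> cball z r \<Longrightarrow> norm (f k s) \<le> B k"
      by blast
    have lim: "uniform_limit (cball z r) (\<lambda>F s. \<Sum>k\<in>F. f k s) (\<lambda>s. \<Sum>\<^sub>\<infinity>k\<in>K. f k s)
                 (finite_subsets_at_top K)"
      by (rule Weierstrass_m_test_general[OF le r(3)]) auto
    have hol: "(\<lambda>s. \<Sum>k\<in>F. f k s) holomorphic_on cball z r" if "F \<subseteq> K" for F
      using that assms(2) r(2) by (intro holomorphic_on_sum) (auto intro: holomorphic_on_subset)
    have ev: "\<forall>\<^sub>F F in finite_subsets_at_top K.
            continuous_on (cball z r) (\<lambda>s. \<Sum>k\<in>F. f k s) \<and>
            (\<lambda>s. \<Sum>k\<in>F. f k s) holomorphic_on ball z r"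
      by (rule eventually_finite_subsets_at_top_weakI)
         (auto intro!: holomorphic_on_imp_continuous_on hol holomorphic_on_subset[OF hol ball_subset_cball])
    obtain "(\<lambda>s. \<Sum>\<^sub>\<infinity>k\<in>K. f k s) holomorphic_on ball z r"
      by (rule holomorphic_uniform_limit[OF ev lim]) auto
    then show ?thesis
      using r(1) by (auto simp: analytic_at intro!: exI[of _ "ball z r"])
  qed
  then show ?thesis
    using analytic_imp_holomorphic analytic_on_analytic_at by blast
qed

text \<open>Decay of order \<open>Re s + n\<close> moves the half-plane of convergence
  \<open>n\<close> units to the left. The case \<open>n = 0\<close> serves the zeta series, positive
  \<open>n\<close> the Taylor remainders.\<close>

lemma holomorphic_on_barnes_series:
  fixes f :: "(nat \<Rightarrow> nat) \<Rightarrow> complex \<Rightarrow> complex" and C :: "complex \<Rightarrow> real"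
  assumes a: "\<And>j. j \<in> {1..M} \<Longrightarrow> a j > 0" and w: "Re w > 0"
    and f: "\<And>k. k \<in> multi_indices M \<Longrightarrow> f k holomorphic_on {s. Re s > real M - real n}"
    and C: "continuous_on UNIV C"
    and le: "\<And>k s. k \<in> multi_indices M \<Longrightarrow> Re s > real M - real n \<Longrightarrow>
               norm (f k s) \<le> C s * norm (w + of_real (lin_comb M a k)) powr (- (Re s + real n))"
  shows "(\<lambda>s. \<Sum>\<^sub>\<infinity>k\<in>multi_indices M. f k s) holomorphic_on {s. Re s > real M - real n}"
    and "Re s > real M - real n \<Longrightarrow> (\<lambda>k. norm (f k s)) summable_on multi_indices M"
proof -
  show "(\<lambda>k. norm (f k s)) summable_on multi_indices M" if "Re s > real M - real n" for s
  proof (rule summable_on_comparison_test)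
    show "(\<lambda>k. C s * norm (w + of_real (lin_comb M a k)) powr (- (Re s + real n)))
            summable_on multi_indices M"
      by (intro summable_on_cmult_right summable_barnes[OF a w]) (use that in auto)
  qed (use le that in auto)
  show "(\<lambda>s. \<Sum>\<^sub>\<infinity>k\<in>multi_indices M. f k s) holomorphic_on {s. Re s > real M - real n}"
  proof (rule holomorphic_on_infsum)
    fix z assume "z \<in> {s. Re s > real M - real n}"
    then have z: "Re z > real M - real n" by simp
    \<comment> \<open>Half the distance from \<open>z\<close> to the boundary line, so that
      \<open>Re s + n \<ge> \<sigma> > M\<close> on the whole closed disc.\<close>
    define r where "r = (Re z + real n - real M) / 2"
    define \<sigma> where "\<sigma> = real M + r"
    have r: "r > 0" using z by (simp add: r_def)
    have Re_ge: "Re s + real n \<ge> \<sigma>" if "s \<in> cball z r" for s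
    proof -
      have "Re z - Re s \<le> r"
        using that complex_Re_le_cmod[of "z - s"] by (simp add: dist_norm)
      then show ?thesis by (simp add: \<sigma>_def r_def field_simps)
    qed
    \<comment> \<open>The excess of \<open>Re s + n\<close> over \<open>\<sigma>\<close> is charged
      to \<open>Re w\<close>, a lower bound of all the norms. This leaves the fixed exponent
      \<open>\<sigma>\<close> and a factor \<open>D\<close> that is bounded on the compact
      disc.\<close>
    define D where "D s = \<bar>C s\<bar> * Re w powr (- (Re s + real n - \<sigma>))" for s
    have "continuous_on (cball z r) D"
      unfolding D_def using w
      by (intro continuous_intros continuous_on_subset[OF C]) auto
    then have "bounded (D ` cball z r)"
      by (intro compact_imp_bounded compact_continuous_image) auto
    then obtain E where E: "\<And>s. s \<in> cball z r \<Longrightarrow> norm (D s) \<le> E"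
      unfolding bounded_iff by blast
    have "norm (f k s) \<le> E * norm (w + of_real (lin_comb M a k)) powr (- \<sigma>)"
      if k: "k \<in> multi_indices M" and s: "s \<in> cball z r" for k s
    proof -
      let ?x = "norm (w + of_real (lin_comb M a k))"
      have x: "?x \<ge> Re w" by (rule norm_add_lin_comb_ge[OF a w])
      have "norm (f k s) \<le> C s * ?x powr (- (Re s + real n))"
        using Re_ge[OF s] r by (intro le k) (auto simp: \<sigma>_def)
      also have "?x powr (- (Re s + real n)) = ?x powr (- (Re s + real n - \<sigma>)) * ?x powr (- \<sigma>)"
        by (simp add: powr_add[symmetric])
      also have "C s * \<dots> \<le> \<bar>C s\<bar> * \<dots>"
        by (intro mult_right_mono) auto
      also have "\<dots> \<le> \<bar>C s\<bar> * (Re w powr (- (Re s + real n - \<sigma>)) * ?x powr (- \<sigma>))"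
        by (intro mult_left_mono mult_right_mono powr_mono2') (use x w Re_ge[OF s] in auto)
      also have "\<dots> = D s * ?x powr (- \<sigma>)"
        by (simp add: D_def)
      also have "\<dots> \<le> E * ?x powr (- \<sigma>)"
        using E[OF s] by (intro mult_right_mono) auto
      finally show ?thesis .
    qed
    moreover have "(\<lambda>k. E * norm (w + of_real (lin_comb M a k)) powr (- \<sigma>)) summable_on multi_indices M"
      by (intro summable_on_cmult_right summable_barnes[OF a w]) (use r in \<open>auto simp: \<sigma>_def\<close>)
    moreover have "cball z r \<subseteq> {s. Re s > real M - real n}"
      using Re_ge r by (force simp: \<sigma>_def)
    ultimately show "\<exists>r>0. \<exists>B. cball z r \<subseteq> {s. Re s > real M - real n} \<and> B summable_on multi_indices M \<and>
          (\<forall>k\<in>multi_indices M. \<forall>s\<in>cball z r. norm (f k s) \<le> B k)"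
      using r
      by (intro exI[of _ r] conjI
            exI[of _ "\<lambda>k. E * norm (w + of_real (lin_comb M a k)) powr (- \<sigma>)"]) simp_all
  qed (use f in \<open>auto simp: open_halfspace_Re_gt\<close>)
qed

section \<open>Taylor remainder of a complex power\<close>

definition taylor_rem :: "nat \<Rightarrow> real \<Rightarrow> complex \<Rightarrow> complex \<Rightarrow> complex" where
  "taylor_rem n \<alpha> s z = (z + of_real \<alpha>) powr (- s) -
     (\<Sum>m<n. (-1) ^ m * pochhammer s m / fact m * of_real \<alpha> ^ m * z powr (- (s + of_nat m)))"

text \<open>The coefficients of \<open>taylor_rem\<close> are the generalised binomial coefficients
  of \<open>- s\<close>. On the segment from \<open>z\<close> to \<open>z + \<alpha>\<close> the
  modulus is at least \<open>norm z\<close>, which bounds the \<open>n\<close>-th derivative, so the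
  remainder gains \<open>n\<close> powers of \<open>norm z\<close>.\<close>

lemma norm_taylor_rem_le:
  assumes "n > 0" and "\<alpha> > 0" and z: "Re z > 0" and s: "Re s + real n \<ge> 0"
  shows "norm (taylor_rem n \<alpha> s z) \<le>
           norm (pochhammer s n) * exp (pi * \<bar>Im s\<bar>) * \<alpha> ^ n / fact (n - 1)
             * norm z powr (- (Re s + real n))"
proof -
  obtain n' where n: "n = Suc n'" using assms(1) by (cases n) auto
  \<comment> \<open>\<open>f i\<close> is the \<open>i\<close>-th derivative of
    \<open>x powr (- s)\<close>, and \<open>B\<close> will bound \<open>f n\<close> on the
    segment.\<close>
  define f where "f i x = (-1) ^ i * pochhammer s i * x powr (- (s + of_nat i))" for i x
  define B where "B = norm (pochhammer s n) * (exp (pi * \<bar>Im s\<bar>) * norm z powr (- (Re s + real n)))"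
  let ?S = "closed_segment z (z + of_real \<alpha>)"
  have Re_ge: "Re x \<ge> Re z" "norm x \<ge> norm z" if x: "x \<in> ?S" for x
  proof -
    obtain u where u: "0 \<le> u" "x = (1 - u) *\<^sub>R z + u *\<^sub>R (z + of_real \<alpha>)"
      using x unfolding closed_segment_def by blast
    then have "x = z + of_real (u * \<alpha>)"
      by (simp add: scaleR_conv_of_real algebra_simps)
    note u = u(1) this
    then show "Re x \<ge> Re z" using assms(2) by simp
    have "norm z \<le> norm x"
      using power_mono[OF \<open>Re x \<ge> Re z\<close>, of 2] u(2) z by (simp add: cmod_def)
    then show "norm x \<ge> norm z" .
  qed
  have "norm (f 0 (z + of_real \<alpha>) - (\<Sum>i\<le>n'. f i z * (z + of_real \<alpha> - z) ^ i / fact i))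
          \<le> B * norm (z + of_real \<alpha> - z) ^ Suc n' / fact n'"
  proof (rule complex_Taylor[where S = ?S])
    fix i x assume x: "x \<in> ?S"
    have "x \<notin> \<real>\<^sub>\<le>\<^sub>0" using Re_ge[OF x] z by (auto simp: complex_nonpos_Reals_iff)
    then have "((\<lambda>x. x powr (- (s + of_nat i))) has_field_derivative
                 - (s + of_nat i) * x powr (- (s + of_nat i) - 1)) (at x)"
      by (rule has_field_derivative_powr)
    then have "(f i has_field_derivative
                 (-1) ^ i * pochhammer s i * (- (s + of_nat i) * x powr (- (s + of_nat i) - 1))) (at x)"
      unfolding f_def by (rule DERIV_cmult)
    moreover have "- (s + of_nat i) - 1 = - (s + of_nat (Suc i))"
      by simp
    ultimately have "(f i has_field_derivative f (Suc i) x) (at x)"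
      by (simp only: f_def pochhammer_Suc power_Suc mult_minus_left mult_minus_right mult_1_left mult.assoc)
    then show "(f i has_field_derivative f (Suc i) x) (at x within ?S)"
      by (rule has_field_derivative_at_within)
  next
    fix x assume x: "x \<in> ?S"
    have "norm (x powr (- (s + of_nat n))) \<le> exp (pi * \<bar>Im s\<bar>) * norm x powr (- (Re s + real n))"
      using norm_powr_uminus_le[of x "s + of_nat n"] by simp
    also have "\<dots> \<le> exp (pi * \<bar>Im s\<bar>) * norm z powr (- (Re s + real n))"
      using Re_ge[OF x] z s by (intro mult_left_mono powr_mono2') auto
    finally show "norm (f (Suc n') x) \<le> B"
      unfolding f_def B_def n[symmetric] by (simp add: norm_mult norm_power mult_left_mono)
  qed auto
  also have "f 0 (z + of_real \<alpha>) - (\<Sum>i\<le>n'. f i z * (z + of_real \<alpha> - z) ^ i / fact i) = taylor_rem n \<alpha> s z"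
    by (simp add: f_def taylor_rem_def n lessThan_Suc_atMost mult_ac)
  finally show ?thesis
    using assms(2) by (simp add: B_def n mult_ac)
qed

section \<open>The Barnes zeta series\<close>

lemma barnes_zeta_series_eq:
  "barnes_zeta_series M a s w =
     (\<Sum>\<^sub>\<infinity>k\<in>multi_indices M. (w + of_real (lin_comb M a k)) powr (- s))"
  by (simp add: barnes_zeta_series_def lin_comb_def)

lemma
  assumes a: "\<And>j. j \<in> {1..M} \<Longrightarrow> a j > 0" and w: "Re w > 0"
  shows holomorphic_on_barnes_zeta_series:
      "(\<lambda>s. barnes_zeta_series M a s w) holomorphic_on {s. Re s > real M}"
    and has_sum_barnes_zeta_series: "Re s > real M \<Longrightarrow>
      ((\<lambda>k. (w + of_real (lin_comb M a k)) powr (- s)) has_sum barnes_zeta_series M a s w)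
         (multi_indices M)"
proof -
  have hol: "(\<lambda>s. (w + of_real (lin_comb M a k)) powr (- s)) holomorphic_on X" for k X
    using lin_comb_nonneg[of M a k, OF a] w
    by (cases "w + of_real (lin_comb M a k) = 0")
       (auto intro!: holomorphic_intros simp: complex_eq_iff)
  have le: "norm ((w + of_real (lin_comb M a k)) powr (- s))
              \<le> exp (pi * \<bar>Im s\<bar>) * norm (w + of_real (lin_comb M a k)) powr (- (Re s + real 0))" for k s
    using norm_powr_uminus_le by simp
  have cont: "continuous_on UNIV (\<lambda>s. exp (pi * \<bar>Im s\<bar>))"
    by (intro continuous_intros)
  note * = holomorphic_on_barnes_series[where M = M and a = a and n = 0 and
      f = "\<lambda>k s. (w + of_real (lin_comb M a k)) powr (- s)", OF a w hol cont le]
  show "(\<lambda>s. barnes_zeta_series M a s w) holomorphic_on {s. Re s > real M}"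
    unfolding barnes_zeta_series_eq using *(1) by simp
  show "((\<lambda>k. (w + of_real (lin_comb M a k)) powr (- s)) has_sum barnes_zeta_series M a s w)
         (multi_indices M)" if "Re s > real M"
    unfolding barnes_zeta_series_eq
    by (rule has_sum_infsum, rule abs_summable_summable, rule *(2)) (use that in auto)
qed

text \<open>Multi-indices whose last coordinate is 0 sum to the series for \<open>M\<close>; in the
  others, lowering that coordinate by 1 shifts \<open>w\<close> by \<open>a (Suc M)\<close>.\<close>

lemma barnes_zeta_series_Suc_shift:
  assumes a: "\<And>j. j \<in> {1..Suc M} \<Longrightarrow> a j > 0" and w: "Re w > 0" and s: "Re s > real (Suc M)"
  shows "barnes_zeta_series (Suc M) a s (w + of_real (a (Suc M))) =
           barnes_zeta_series (Suc M) a s w - barnes_zeta_series M a s w"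
proof -
  let ?K = "multi_indices (Suc M)" and ?n = "Suc M"
  let ?f = "\<lambda>k. (w + of_real (lin_comb (Suc M) a k)) powr (- s)"
  let ?A = "{k \<in> ?K. k ?n = 0}" and ?B = "{k \<in> ?K. k ?n \<noteq> 0}"
  have lin_Suc: "lin_comb (Suc M) a k = lin_comb M a k + real (k ?n) * a ?n" for k
    by (simp add: lin_comb_def)
  have lin_upd: "lin_comb M a (k(?n := x)) = lin_comb M a k" for k x
    unfolding lin_comb_def by (intro sum.cong) auto
  have sum: "?f summable_on ?K"
    by (rule has_sum_imp_summable[OF has_sum_barnes_zeta_series[of "Suc M" a w s]])
       (use a w s in auto)
  have "barnes_zeta_series (Suc M) a s w = infsum ?f (?A \<union> ?B)"
    unfolding barnes_zeta_series_eq by (rule arg_cong[of _ _ "infsum ?f"]) blast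
  also have "\<dots> = infsum ?f ?A + infsum ?f ?B"
    by (intro infsum_Un_disjoint summable_on_subset_banach[OF sum]) auto
  \<comment> \<open>Members of a \<open>PiE\<close> set are \<open>undefined\<close> outside their
    domain, so dropping the last coordinate means resetting it to \<open>undefined\<close>.\<close>
  also have "infsum ?f ?A = barnes_zeta_series M a s w"
    unfolding barnes_zeta_series_eq
    by (rule infsum_reindex_bij_witness[where j = "\<lambda>k. k(?n := undefined)" and i = "\<lambda>k. k(?n := 0)"])
       (auto simp: lin_Suc lin_upd PiE_iff extensional_def fun_eq_iff)
  also have "infsum ?f ?B = barnes_zeta_series (Suc M) a s (w + of_real (a ?n))"
    unfolding barnes_zeta_series_eq
    by (rule infsum_reindex_bij_witness[where j = "\<lambda>k. k(?n := k ?n - 1)" and i = "\<lambda>k. k(?n := Suc (k ?n))"])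
       (auto simp: lin_Suc lin_upd PiE_iff extensional_def fun_eq_iff algebra_simps of_nat_diff Suc_le_eq)
  finally show ?thesis by simp
qed

lemma has_sum_finite_sum:
  fixes f :: "'i \<Rightarrow> 'k \<Rightarrow> 'b :: {comm_monoid_add, topological_comm_monoid_add}"
  assumes "\<And>i. i \<in> I \<Longrightarrow> (f i has_sum S i) A"
  shows "((\<lambda>k. \<Sum>i\<in>I. f i k) has_sum (\<Sum>i\<in>I. S i)) A"
  using assms by (induction I rule: infinite_finite_induct) (simp_all add: has_sum_add)

section \<open>Taylor's formula for the zeta series\<close>

definition barnes_taylor_rem ::
    "nat \<Rightarrow> (nat \<Rightarrow> real) \<Rightarrow> nat \<Rightarrow> real \<Rightarrow> complex \<Rightarrow> complex \<Rightarrow> complex" where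
  "barnes_taylor_rem M a n \<alpha> w s =
     (\<Sum>\<^sub>\<infinity>k\<in>multi_indices M. taylor_rem n \<alpha> s (w + of_real (lin_comb M a k)))"

lemma continuous_on_pochhammer [continuous_intros]:
  fixes f :: "'a :: topological_space \<Rightarrow> complex"
  assumes "continuous_on A f"
  shows "continuous_on A (\<lambda>x. pochhammer (f x) n)"
  unfolding pochhammer_prod
  by (rule continuous_on_prod, rule continuous_on_add, rule assms, rule continuous_on_const)

lemma holomorphic_on_pochhammer_compose:
  assumes "f holomorphic_on A"
  shows "(\<lambda>x. pochhammer (f x) n) holomorphic_on A"
  unfolding pochhammer_prod
  by (rule holomorphic_on_prod, rule holomorphic_on_add, rule assms, rule holomorphic_on_const)

text \<open>This is the source of the continuation: the \<open>n\<close> powers gained in each term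
  let the summed remainder converge \<open>n\<close> units further left than the zeta
  series.\<close>

lemma holomorphic_on_barnes_taylor_rem:
  assumes a: "\<And>j. j \<in> {1..M} \<Longrightarrow> a j > 0" and w: "Re w > 0" and n: "n > 0" and \<alpha>: "\<alpha> > 0"
  shows "barnes_taylor_rem M a n \<alpha> w holomorphic_on {s. Re s > real M - real n}"
proof -
  let ?z = "\<lambda>k. w + of_real (lin_comb M a k)"
  have z: "Re (?z k) > 0" for k
    using lin_comb_nonneg[of M a k, OF a] w by simp
  show ?thesis
    unfolding barnes_taylor_rem_def
  proof (rule holomorphic_on_barnes_series(1)[of M a w, OF a w,
           where C = "\<lambda>s. norm (pochhammer s n) * exp (pi * \<bar>Im s\<bar>) * \<alpha> ^ n / fact (n - 1)"])
    fix k
    have "?z k \<noteq> 0" "?z k + of_real \<alpha> \<noteq> 0"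
      using z[of k] \<alpha> by (auto simp: complex_eq_iff)
    then show "(\<lambda>s. taylor_rem n \<alpha> s (?z k)) holomorphic_on {s. Re s > real M - real n}"
      unfolding taylor_rem_def
      by (intro holomorphic_intros holomorphic_on_pochhammer_compose) auto
    show "norm (taylor_rem n \<alpha> s (?z k)) \<le> norm (pochhammer s n) * exp (pi * \<bar>Im s\<bar>) * \<alpha> ^ n
            / fact (n - 1) * norm (?z k) powr (- (Re s + real n))"
      if "Re s > real M - real n" for s
      by (intro norm_taylor_rem_le n \<alpha> z) (use that in simp)
  qed (auto intro!: continuous_intros)
qed

text \<open>Each term is expanded in powers of \<open>\<alpha>\<close> and the result summed over
  \<open>k\<close>. Only finitely many \<open>m\<close> occur, so the sums may be exchanged
  freely.\<close>

lemma barnes_zeta_series_taylor: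
  assumes a: "\<And>j. j \<in> {1..M} \<Longrightarrow> a j > 0" and w: "Re w > 0" and \<alpha>: "\<alpha> > 0"
    and s: "Re s > real M"
  shows "barnes_zeta_series M a s (w + of_real \<alpha>) =
           (\<Sum>m<n. (-1) ^ m * pochhammer s m / fact m * of_real \<alpha> ^ m *
              barnes_zeta_series M a (s + of_nat m) w) + barnes_taylor_rem M a n \<alpha> w s"
proof -
  let ?z = "\<lambda>k. w + of_real (lin_comb M a k)"
  have "((\<lambda>k. ?z k powr (- (s + of_nat m))) has_sum barnes_zeta_series M a (s + of_nat m) w)
          (multi_indices M)" for m
    by (rule has_sum_barnes_zeta_series[of M a w, OF a w]) (use s in auto)
  then have "((\<lambda>k. \<Sum>m<n. (-1) ^ m * pochhammer s m / fact m * of_real \<alpha> ^ m * ?z k powr (- (s + of_nat m)))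
          has_sum (\<Sum>m<n. (-1) ^ m * pochhammer s m / fact m * of_real \<alpha> ^ m *
                     barnes_zeta_series M a (s + of_nat m) w)) (multi_indices M)"
    by (intro has_sum_finite_sum has_sum_cmult_right)
  moreover have "((\<lambda>k. (w + of_real \<alpha> + of_real (lin_comb M a k)) powr (- s))
      has_sum barnes_zeta_series M a s (w + of_real \<alpha>)) (multi_indices M)"
    by (rule has_sum_barnes_zeta_series[of M a, OF a]) (use s w \<alpha> in auto)
  then have "((\<lambda>k. (?z k + of_real \<alpha>) powr (- s)) has_sum
      barnes_zeta_series M a s (w + of_real \<alpha>)) (multi_indices M)"
    by (simp only: add.assoc add.commute[of "of_real \<alpha>"])
  ultimately have "((\<lambda>k. taylor_rem n \<alpha> s (?z k)) has_sum
      (barnes_zeta_series M a s (w + of_real \<alpha>) -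
        (\<Sum>m<n. (-1) ^ m * pochhammer s m / fact m * of_real \<alpha> ^ m *
              barnes_zeta_series M a (s + of_nat m) w))) (multi_indices M)"
    unfolding taylor_rem_def diff_conv_add_uminus by (intro has_sum_add has_sum_uminusI)
  then show ?thesis
    by (simp add: barnes_taylor_rem_def infsumI)
qed

text \<open>At \<open>s = -t\<close> the power is a polynomial of degree \<open>t\<close>, and
  Taylor's formula is the exact binomial theorem.\<close>

lemma taylor_rem_uminus_nat:
  assumes "t < n" and "z \<noteq> 0" and "z + of_real \<alpha> \<noteq> 0"
  shows "taylor_rem n \<alpha> (- of_nat t) z = 0"
proof -
  have "(z + of_real \<alpha>) ^ t = (\<Sum>m\<le>t. of_nat (t choose m) * of_real \<alpha> ^ m * z ^ (t - m))"
    by (subst add.commute) (rule binomial_ring)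
  also have "\<dots> = (\<Sum>m\<le>t. (-1) ^ m * pochhammer (- of_nat t) m / fact m * of_real \<alpha> ^ m *
                     z powr (- (- of_nat t + of_nat m)))"
  proof (rule sum.cong)
    fix m assume m: "m \<in> {..t}"
    have "of_nat (t choose m) = (-1) ^ m * pochhammer (- of_nat t) m / (fact m :: complex)"
      by (simp add: binomial_gbinomial gbinomial_pochhammer)
    moreover have "- (- of_nat t + of_nat m) = (of_nat (t - m) :: complex)"
      using m by (simp add: of_nat_diff)
    ultimately show "of_nat (t choose m) * of_real \<alpha> ^ m * z ^ (t - m) =
       (-1) ^ m * pochhammer (- of_nat t) m / fact m * of_real \<alpha> ^ m * z powr (- (- of_nat t + of_nat m))"
      by (simp only: powr_complexpow[OF assms(2)])
  qed simp
  \<comment> \<open>The added terms have \<open>m > t\<close>, where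
    \<open>pochhammer (- t) m\<close> contains the factor 0.\<close>
  also have "\<dots> = (\<Sum>m<n. (-1) ^ m * pochhammer (- of_nat t) m / fact m * of_real \<alpha> ^ m *
                     z powr (- (- of_nat t + of_nat m)))"
    by (rule sum.mono_neutral_left) (use assms(1) in \<open>auto simp: pochhammer_of_nat_eq_0_iff\<close>)
  finally show ?thesis
    using assms(3) by (simp add: taylor_rem_def)
qed

text \<open>By the identity theorem the extensions agree on overlaps, so they glue to an entire
  function.\<close>

lemma holomorphic_extend_left:
  fixes f :: "complex \<Rightarrow> complex"
  assumes "\<And>j :: nat. \<exists>F. F holomorphic_on {s. Re s > c - real j} \<and> (\<forall>s. Re s > c \<longrightarrow> F s = f s)"
  shows "\<exists>F. F holomorphic_on UNIV \<and> (\<forall>s. Re s > c \<longrightarrow> F s = f s)"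
proof -
  obtain F where F: "\<And>j. F j holomorphic_on {s. Re s > c - real j}" "\<And>j s. Re s > c \<Longrightarrow> F j s = f s"
    using assms by metis
  have eq: "F i s = F j s" if "i \<le> j" "Re s > c - real i" for i j s
  proof (rule analytic_continuation_open[of "{s. Re s > c}" "{s. Re s > c - real i}" "F i" "F j"])
    show "{s. Re s > c} \<noteq> {}"
      by (auto intro!: exI[of _ "of_real (c + 1)"])
    show "F j holomorphic_on {s. Re s > c - real i}"
      by (rule holomorphic_on_subset[OF F(1)]) (use that in auto)
  qed (use that F in \<open>auto simp: open_halfspace_Re_gt intro: convex_connected convex_halfspace_Re_gt\<close>)
  \<comment> \<open>The added 1 makes the inequality \<open>Re s > c - N s\<close> strict;
    \<open>G\<close> does not depend on this choice of index.\<close>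
  define N where "N s = nat \<lceil>c - Re s\<rceil> + 1" for s
  define G where "G s = F (N s) s" for s
  have G: "G s = F j s" if "Re s > c - real j" for j s
  proof -
    have "Re s > c - real (N s)"
      unfolding N_def by linarith
    then show ?thesis
      unfolding G_def using eq[of "N s" j s] eq[of j "N s" s] that by (metis nle_le)
  qed
  have "G analytic_on {s}" for s
  proof -
    have "G holomorphic_on {s'. Re s' > c - real (N s)}"
      by (rule holomorphic_transform[OF F(1)]) (use G in auto)
    moreover have "Re s > c - real (N s)"
      unfolding N_def by linarith
    ultimately show ?thesis
      unfolding analytic_at using open_halfspace_Re_gt by blast
  qed
  then have "G holomorphic_on UNIV"
    using analytic_imp_holomorphic analytic_on_analytic_at by blast
  moreover have "G s = f s" if "Re s > c" for s
    using G[of 0 s] F(2)[of s 0] that by simp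
  ultimately show ?thesis by blast
qed

section \<open>Continuation of the Barnes zeta function\<close>

text \<open>Both sides multiply the consecutive factors \<open>s - M, ..., s + m - 1\<close>. The
  last \<open>M + 1\<close> of them are exactly those that clear the poles of the zeta function for
  \<open>Suc M\<close> at \<open>s + m\<close>.\<close>

lemma barnes_pochhammer_factor:
  fixes s :: complex
  assumes "m \<ge> 1"
  shows "pochhammer (s - of_nat M) M * pochhammer s m =
           pochhammer (s - of_nat M) (m - 1) * pochhammer (s + of_nat m - of_nat (Suc M)) (Suc M)"
proof -
  have "pochhammer (s - of_nat M) M * pochhammer s m = pochhammer (s - of_nat M) (M + m)"
    using pochhammer_product'[of "s - of_nat M" M m] by simp
  also have "M + m = m - 1 + Suc M"
    using assms by simp
  also have "pochhammer (s - of_nat M) \<dots> = pochhammer (s - of_nat M) (m - 1) *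
               pochhammer (s - of_nat M + of_nat (m - 1)) (Suc M)"
    by (rule pochhammer_product')
  also have "s - of_nat M + of_nat (m - 1) = s + of_nat m - of_nat (Suc M)"
    using assms by (simp add: of_nat_diff)
  finally show ?thesis .
qed

text \<open>\<open>G\<close> and \<open>F\<close> stand for the cleared zeta functions for
  \<open>M\<close> and \<open>Suc M\<close>, \<open>R\<close> for the Taylor remainder. They are
  parameters so that one expression serves both the series and their continuations.\<close>

definition barnes_recursion_rhs ::
    "nat \<Rightarrow> nat \<Rightarrow> real \<Rightarrow> (complex \<Rightarrow> complex) \<Rightarrow> (complex \<Rightarrow> complex) \<Rightarrow> (complex \<Rightarrow> complex) \<Rightarrow>
       complex \<Rightarrow> complex" where
  "barnes_recursion_rhs M n \<alpha> G F R s = G s +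
     (\<Sum>m\<in>{2..<n}. (-1) ^ m / fact m * of_real \<alpha> ^ m * pochhammer (s - of_nat M) (m - 1) *
        F (s + of_nat m)) + pochhammer (s - of_nat M) M * R s"

text \<open>
  Since \<open>pochhammer (s - M) M = (s - 1) \<dots> (s - M)\<close>, this is the zeta series with its poles cleared.
\<close>

definition barnes_cleared :: "nat \<Rightarrow> (nat \<Rightarrow> real) \<Rightarrow> complex \<Rightarrow> complex \<Rightarrow> complex" where
  "barnes_cleared M a w s = pochhammer (s - of_nat M) M * barnes_zeta_series M a s w"

text \<open>In Taylor's formula with shift \<open>a (Suc M)\<close> the terms for
  \<open>m = 0\<close> cancel against the shift identity, and the equation is solved for the term
  \<open>m = 1\<close>.\<close>

lemma barnes_cleared_recursion:
  assumes a: "\<And>j. j \<in> {1..Suc M} \<Longrightarrow> a j > 0" and w: "Re w > 0" and n: "n \<ge> 2"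
    and s: "Re s > real (Suc M)"
  shows "of_real (a (Suc M)) * barnes_cleared (Suc M) a w (s + 1) =
           barnes_recursion_rhs M n (a (Suc M)) (barnes_cleared M a w) (barnes_cleared (Suc M) a w)
             (barnes_taylor_rem (Suc M) a n (a (Suc M)) w) s"
proof -
  let ?\<alpha> = "a (Suc M)" and ?P = "pochhammer (s - of_nat M) M"
  define Z where "Z m = barnes_zeta_series (Suc M) a (s + of_nat m) w" for m
  define t where "t m = (-1) ^ m * pochhammer s m / fact m * of_real ?\<alpha> ^ m * Z m" for m
  define R where "R = barnes_taylor_rem (Suc M) a n ?\<alpha> w s"
  have \<alpha>: "?\<alpha> > 0" using a by simp
  have "Z 0 - barnes_zeta_series M a s w = (\<Sum>m<n. t m) + R"
    using barnes_zeta_series_taylor[of "Suc M" a w ?\<alpha> s n] barnes_zeta_series_Suc_shift[of M a w s] a w \<alpha> s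
    by (simp add: Z_def t_def R_def)
  also have "{..<n} = insert 0 (insert 1 {2..<n})"
    using n by auto
  also have "(\<Sum>m\<in>\<dots>. t m) = Z 0 - s * of_real ?\<alpha> * Z 1 + (\<Sum>m\<in>{2..<n}. t m)"
    by (simp add: t_def)
  finally have "of_real ?\<alpha> * (s * Z 1) = barnes_zeta_series M a s w + (\<Sum>m\<in>{2..<n}. t m) + R"
    by (simp add: algebra_simps)
  then have "?P * (of_real ?\<alpha> * (s * Z 1)) = ?P * (barnes_zeta_series M a s w + (\<Sum>m\<in>{2..<n}. t m) + R)"
    by simp
  also have "?P * (of_real ?\<alpha> * (s * Z 1)) = of_real ?\<alpha> * ((?P * pochhammer s 1) * Z 1)"
    by simp
  \<comment> \<open>For \<open>m = 1\<close> the first factor in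
    \<open>barnes_pochhammer_factor\<close> is an empty product.\<close>
  also have "\<dots> = of_real ?\<alpha> * barnes_cleared (Suc M) a w (s + 1)"
    by (subst barnes_pochhammer_factor) (simp_all add: barnes_cleared_def Z_def)
  also have "?P * (barnes_zeta_series M a s w + (\<Sum>m\<in>{2..<n}. t m) + R) =
      barnes_cleared M a w s + (\<Sum>m\<in>{2..<n}. ?P * t m) + ?P * R"
    by (simp add: barnes_cleared_def distrib_left sum_distrib_left)
  also have "(\<Sum>m\<in>{2..<n}. ?P * t m) = (\<Sum>m\<in>{2..<n}. (-1) ^ m / fact m * of_real ?\<alpha> ^ m *
               pochhammer (s - of_nat M) (m - 1) * barnes_cleared (Suc M) a w (s + of_nat m))"
  proof (rule sum.cong)
    fix m assume "m \<in> {2..<n}"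
    then have m: "m \<ge> 1" by simp
    have "?P * t m = (-1) ^ m / fact m * of_real ?\<alpha> ^ m * (?P * pochhammer s m) * Z m"
      by (simp add: t_def)
    also have "\<dots> = (-1) ^ m / fact m * of_real ?\<alpha> ^ m * pochhammer (s - of_nat M) (m - 1) *
                     barnes_cleared (Suc M) a w (s + of_nat m)"
      unfolding barnes_pochhammer_factor[OF m] barnes_cleared_def Z_def by (simp only: mult.assoc)
    finally show "?P * t m = \<dots>" .
  qed simp
  finally show ?thesis
    by (simp add: barnes_recursion_rhs_def R_def)
qed

text \<open>A relation rather than a chosen function: scaling then only has to transform a given
  witness.\<close>

definition barnes_continuation ::
    "nat \<Rightarrow> (nat \<Rightarrow> real) \<Rightarrow> complex \<Rightarrow> (complex \<Rightarrow> complex) \<Rightarrow> bool" where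
  "barnes_continuation M a w F \<longleftrightarrow>
     F holomorphic_on UNIV \<and> (\<forall>s. Re s > real M \<longrightarrow> F s = barnes_cleared M a w s)"

lemma halfplane_identity:
  assumes f: "f holomorphic_on {s. Re s > c}" and g: "g holomorphic_on {s. Re s > c}"
    and eq: "\<And>s. Re s > d \<Longrightarrow> f s = g s" and s: "Re s > c"
  shows "f s = g s"
proof (cases "c \<le> d")
  case True
  show ?thesis
  proof (rule analytic_continuation_open[of "{s. Re s > d}" "{s. Re s > c}" f g])
    show "{s. Re s > d} \<noteq> {}"
      by (auto intro!: exI[of _ "of_real (d + 1)"])
  qed (use assms True in \<open>auto simp: open_halfspace_Re_gt intro: convex_connected convex_halfspace_Re_gt\<close>)
qed (use assms in auto)

text \<open>Only arguments \<open>s + m\<close> with \<open>m \<ge> 2\<close> reach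
  \<open>F\<close>, hence the half-plane with \<open>c + 2\<close> suffices for it.\<close>

lemma holomorphic_on_barnes_recursion_rhs:
  assumes "G holomorphic_on UNIV" and "R holomorphic_on {s. Re s > c}"
    and F: "F holomorphic_on {s. Re s > c + 2}"
  shows "barnes_recursion_rhs M n \<alpha> G F R holomorphic_on {s. Re s > c}"
proof -
  have "(\<lambda>s. F (s + of_nat m)) holomorphic_on {s. Re s > c}" if "m \<in> {2..<n}" for m
  proof -
    have "F \<circ> (\<lambda>s. s + of_nat m) holomorphic_on {s. Re s > c}"
      by (rule holomorphic_on_compose_gen[OF _ F]) (use that in \<open>auto intro!: holomorphic_intros\<close>)
    then show ?thesis by (simp add: o_def)
  qed
  moreover have "G holomorphic_on {s. Re s > c}"
    using assms(1) by (rule holomorphic_on_subset) auto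
  ultimately show ?thesis
    unfolding barnes_recursion_rhs_def[abs_def] using assms(2)
    by (intro holomorphic_intros holomorphic_on_pochhammer_compose)
qed

text \<open>The recursion gives the value at \<open>s + 1\<close> from values at
  \<open>s + 2\<close> and further right, so each use extends the domain by one unit. The inner
  induction on \<open>j\<close> repeats this; the outer one on \<open>M\<close> supplies
  \<open>G\<close>.\<close>

lemma barnes_continuation_exists:
  assumes "\<And>j. j \<in> {1..M} \<Longrightarrow> a j > 0" and w: "Re w > 0"
  shows "\<exists>F. barnes_continuation M a w F"
  using assms(1)
proof (induction M)
  case 0
  have "w \<noteq> 0" using w by auto
  then have "(\<lambda>s. w powr (- s)) holomorphic_on UNIV"
    by (intro holomorphic_intros)
  then show ?case
    by (auto simp: barnes_continuation_def barnes_cleared_def barnes_zeta_series_def intro!: exI)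
next
  case (Suc M)
  let ?\<alpha> = "a (Suc M)"
  note a = Suc.prems
  define f where "f = barnes_cleared (Suc M) a w"
  have \<alpha>: "?\<alpha> > 0" using a by simp
  obtain G where G: "G holomorphic_on UNIV" "\<And>s. Re s > real M \<Longrightarrow> G s = barnes_cleared M a w s"
    using Suc by (auto simp: barnes_continuation_def)
  have f: "f holomorphic_on {s. Re s > real (Suc M)}"
    unfolding f_def barnes_cleared_def[abs_def]
    by (intro holomorphic_intros holomorphic_on_pochhammer_compose holomorphic_on_barnes_zeta_series a w)
  have "\<exists>F. F holomorphic_on {s. Re s > real (Suc M) - real j} \<and> (\<forall>s. Re s > real (Suc M) \<longrightarrow> F s = f s)" for j
  proof (induction j)
    case 0
    show ?case using f by auto
  next
    case (Suc j)
    then obtain F where F: "F holomorphic_on {s. Re s > real (Suc M) - real j}"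
        "\<And>s. Re s > real (Suc M) \<Longrightarrow> F s = f s"
      by blast
    \<comment> \<open>With this \<open>n\<close>, the known half-plane of \<open>F\<close> is
      \<open>Re s > c + 2\<close> and the new one is \<open>Re s > c + 1\<close>.\<close>
    define n where "n = j + 2"
    define c where "c = real (Suc M) - real n"
    let ?R = "barnes_taylor_rem (Suc M) a n ?\<alpha> w"
    let ?H = "barnes_recursion_rhs M n ?\<alpha> G F ?R"
    have "?H holomorphic_on {s. Re s > c}"
    proof (rule holomorphic_on_barnes_recursion_rhs[OF G(1)])
      show "?R holomorphic_on {s. Re s > c}"
        unfolding c_def by (intro holomorphic_on_barnes_taylor_rem a w \<alpha>) (auto simp: n_def)
      show "F holomorphic_on {s. Re s > c + 2}"
        by (rule holomorphic_on_subset[OF F(1)]) (auto simp: c_def n_def)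
    qed
    then have "?H \<circ> (\<lambda>s. s - 1) holomorphic_on {s. Re s > c + 1}"
      by (rule holomorphic_on_compose_gen[rotated]) (auto intro!: holomorphic_intros)
    then have H: "(\<lambda>s. ?H (s - 1) / of_real ?\<alpha>) holomorphic_on {s. Re s > c + 1}"
      unfolding o_def using \<alpha> by (intro holomorphic_intros) auto
    \<comment> \<open>The recursion is applied at \<open>s - 1\<close>, which costs one unit; the
      identity theorem below recovers it.\<close>
    have eq: "?H (s - 1) / of_real ?\<alpha> = f s" if s: "Re s > real (Suc M) + 1" for s
    proof -
      have "of_real ?\<alpha> * f (s - 1 + 1) =
              barnes_recursion_rhs M n ?\<alpha> (barnes_cleared M a w) f ?R (s - 1)"
        unfolding f_def by (rule barnes_cleared_recursion) (use a w s in \<open>auto simp: n_def\<close>)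
      also have "\<dots> = ?H (s - 1)"
        unfolding barnes_recursion_rhs_def using s G(2) F(2)
        by (intro arg_cong2[where f = "(+)"] sum.cong arg_cong2[where f = "(*)"] refl) auto
      finally show ?thesis using \<alpha> by (simp add: field_simps)
    qed
    have "?H (s - 1) / of_real ?\<alpha> = f s" if "Re s > real (Suc M)" for s
    proof (rule halfplane_identity[OF _ f eq that])
      show "(\<lambda>s. ?H (s - 1) / of_real ?\<alpha>) holomorphic_on {s. Re s > real (Suc M)}"
        by (rule holomorphic_on_subset[OF H]) (auto simp: c_def n_def)
    qed
    moreover have "c + 1 = real (Suc M) - real (Suc j)"
      by (simp add: c_def n_def)
    ultimately show ?case
      using H by (intro exI[of _ "\<lambda>s. ?H (s - 1) / of_real ?\<alpha>"]) simp
  qed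
  then have "\<exists>F. F holomorphic_on UNIV \<and> (\<forall>s. Re s > real (Suc M) \<longrightarrow> F s = f s)"
    by (rule holomorphic_extend_left)
  then show ?case
    by (simp add: barnes_continuation_def f_def)
qed

text \<open>The identity theorem carries the recursion from the region of convergence to the
  half-plane where the remainder is holomorphic.\<close>

lemma barnes_continuation_recursion:
  assumes a: "\<And>j. j \<in> {1..Suc M} \<Longrightarrow> a j > 0" and w: "Re w > 0" and n: "n \<ge> 2"
    and F: "barnes_continuation (Suc M) a w F" and G: "barnes_continuation M a w G"
    and s: "Re s > real (Suc M) - real n"
  shows "of_real (a (Suc M)) * F (s + 1) =
           barnes_recursion_rhs M n (a (Suc M)) G F (barnes_taylor_rem (Suc M) a n (a (Suc M)) w) s"
proof -
  let ?\<alpha> = "a (Suc M)" and ?R = "barnes_taylor_rem (Suc M) a n (a (Suc M)) w"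
  have \<alpha>: "?\<alpha> > 0" using a by simp
  have F': "F holomorphic_on UNIV" "\<And>s. Re s > real (Suc M) \<Longrightarrow> F s = barnes_cleared (Suc M) a w s"
    using F by (auto simp: barnes_continuation_def)
  have G': "G holomorphic_on UNIV" "\<And>s. Re s > real M \<Longrightarrow> G s = barnes_cleared M a w s"
    using G by (auto simp: barnes_continuation_def)
  show ?thesis
  proof (rule halfplane_identity[OF _ _ _ s])
    have "F \<circ> (\<lambda>s. s + 1) holomorphic_on {s. Re s > real (Suc M) - real n}"
      by (rule holomorphic_on_compose_gen[OF _ F'(1)]) (auto intro!: holomorphic_intros)
    then show "(\<lambda>s. of_real ?\<alpha> * F (s + 1)) holomorphic_on {s. Re s > real (Suc M) - real n}"
      unfolding o_def by (intro holomorphic_intros)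
    show "barnes_recursion_rhs M n ?\<alpha> G F ?R holomorphic_on {s. Re s > real (Suc M) - real n}"
      by (intro holomorphic_on_barnes_recursion_rhs holomorphic_on_barnes_taylor_rem a w \<alpha> G'(1)
            holomorphic_on_subset[OF F'(1)]) (use n in auto)
    fix s :: complex assume s: "Re s > real (Suc M)"
    have "of_real ?\<alpha> * F (s + 1) = of_real ?\<alpha> * barnes_cleared (Suc M) a w (s + 1)"
      using F'(2)[of "s + 1"] s by simp
    also have "\<dots> = barnes_recursion_rhs M n ?\<alpha> (barnes_cleared M a w) (barnes_cleared (Suc M) a w) ?R s"
      by (rule barnes_cleared_recursion) (use a w n s in auto)
    also have "\<dots> = barnes_recursion_rhs M n ?\<alpha> G F ?R s"
      unfolding barnes_recursion_rhs_def using s G'(2) F'(2)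
      by (intro arg_cong2[where f = "(+)"] sum.cong arg_cong2[where f = "(*)"] refl) auto
    finally show "of_real ?\<alpha> * F (s + 1) = barnes_recursion_rhs M n ?\<alpha> G F ?R s" .
  qed
qed

text \<open>The recursion at \<open>s = M - j\<close> expresses \<open>F w (M + 1 - j)\<close>
  through the value for \<open>M\<close> with the same \<open>j\<close> and values for
  \<open>M + 1\<close> with smaller \<open>j\<close>; the remainder term vanishes. Hence an
  induction on \<open>M\<close> and, inside it, a strong one on \<open>j\<close>.\<close>

lemma barnes_continuation_polynomial:
  assumes "\<And>j. j \<in> {1..M} \<Longrightarrow> a j > 0"
    and "\<And>w. Re w > 0 \<Longrightarrow> barnes_continuation M a w (F w)"
  shows "\<exists>p. degree p \<le> j \<and> (\<forall>w. Re w > 0 \<longrightarrow> F w (of_nat M - of_nat j) = poly p w)"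
  using assms
proof (induction M arbitrary: F j)
  case 0
  have "F w (- of_nat j) = w ^ j" if w: "Re w > 0" for w
  proof -
    have [simp]: "w \<noteq> 0" using w by auto
    have "F w (- of_nat j) = w powr (- (- of_nat j))"
    proof (rule halfplane_identity[where c = "- real j - 1" and d = 0 and f = "F w" and g = "\<lambda>s. w powr (- s)"])
      show "F w holomorphic_on {s. Re s > - real j - 1}"
        using 0(2)[OF w] by (auto simp: barnes_continuation_def intro: holomorphic_on_subset)
      show "(\<lambda>s. w powr (- s)) holomorphic_on {s. Re s > - real j - 1}"
        by (intro holomorphic_intros)
    qed (use 0(2)[OF w] in \<open>auto simp: barnes_continuation_def barnes_cleared_def barnes_zeta_series_def\<close>)
    then show ?thesis by simp
  qed
  then show ?case
    by (intro exI[of _ "monom 1 j"]) (auto simp: degree_monom_eq poly_monom)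
next
  case (Suc M)
  let ?\<alpha> = "a (Suc M)"
  have \<alpha>: "?\<alpha> > 0" using Suc.prems by simp
  have "\<forall>w. \<exists>G. Re w > 0 \<longrightarrow> barnes_continuation M a w G"
    using barnes_continuation_exists[of M a] Suc.prems(1) by auto
  then obtain G where G: "\<And>w. Re w > 0 \<Longrightarrow> barnes_continuation M a w (G w)"
    by metis
  show ?case
  proof (induction j rule: less_induct)
    case (less j)
    \<comment> \<open>Large enough for the recursion to hold at \<open>s\<close>, yet
      \<open>m \<le> j + 1\<close> for all \<open>m < n\<close>, so the natural subtraction
      \<open>j + 1 - m\<close> is exact.\<close>
    define n where "n = j + 2"
    define s :: complex where "s = of_nat M - of_nat j"
    define c :: "nat \<Rightarrow> complex"
      where "c m = (-1) ^ m / fact m * of_real ?\<alpha> ^ m * pochhammer (s - of_nat M) (m - 1)" for m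
    obtain q where q: "degree q \<le> j" "\<And>w. Re w > 0 \<Longrightarrow> G w s = poly q w"
      unfolding s_def using Suc.IH[of G j] Suc.prems(1) G by auto
    have "\<exists>p. degree p \<le> j \<and> (\<forall>w. Re w > 0 \<longrightarrow> F w (s + of_nat m) = poly p w)" if m: "m \<in> {2..<n}" for m
    proof -
      have "j + 1 - m < j" "m \<le> j + 1" using m by (auto simp: n_def)
      then have "s + of_nat m = of_nat (Suc M) - of_nat (j + 1 - m)"
        by (simp add: s_def of_nat_diff)
      then show ?thesis
        using less.IH[OF \<open>j + 1 - m < j\<close>] by (metis \<open>j + 1 - m < j\<close> le_trans less_imp_le)
    qed
    then obtain r where r: "\<And>m. m \<in> {2..<n} \<Longrightarrow> degree (r m) \<le> j"
        "\<And>m w. m \<in> {2..<n} \<Longrightarrow> Re w > 0 \<Longrightarrow> F w (s + of_nat m) = poly (r m) w"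
      by metis
    define p where "p = smult (inverse (of_real ?\<alpha>)) (q + (\<Sum>m\<in>{2..<n}. smult (c m) (r m)))"
    have "degree p \<le> j"
      unfolding p_def
      by (intro order.trans[OF degree_smult_le] degree_add_le degree_sum_le q r) auto
    moreover have "F w (of_nat (Suc M) - of_nat j) = poly p w" if w: "Re w > 0" for w
    proof -
      let ?R = "barnes_taylor_rem (Suc M) a n ?\<alpha> w"
      \<comment> \<open>There are two reasons: for \<open>j < M\<close> the point \<open>s\<close>
        is among \<open>1, ..., M\<close> and the clearing factor is 0; otherwise \<open>s\<close>
        is a nonpositive integer and every Taylor remainder is 0.\<close>
      have R: "pochhammer (s - of_nat M) M * ?R s = 0"
      proof (cases "j < M")
        case True
        then show ?thesis by (simp add: s_def pochhammer_of_nat_eq_0_iff)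
      next
        case False
        then have s: "s = - of_nat (j - M)" by (simp add: s_def of_nat_diff)
        have "taylor_rem n ?\<alpha> s (w + of_real (lin_comb (Suc M) a k)) = 0" for k
        proof -
          have "Re (w + of_real (lin_comb (Suc M) a k)) > 0"
            using lin_comb_nonneg[of "Suc M" a k, OF Suc.prems(1)] w by simp
          then show ?thesis
            unfolding s using \<alpha> by (intro taylor_rem_uminus_nat) (auto simp: n_def complex_eq_iff)
        qed
        then show ?thesis by (simp add: barnes_taylor_rem_def)
      qed
      have "of_real ?\<alpha> * F w (s + 1) = barnes_recursion_rhs M n ?\<alpha> (G w) (F w) ?R s"
        by (rule barnes_continuation_recursion)
           (use Suc.prems w G[OF w] in \<open>auto simp: n_def s_def\<close>)
      also have "\<dots> = poly q w + (\<Sum>m\<in>{2..<n}. c m * poly (r m) w)"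
        unfolding barnes_recursion_rhs_def R using q(2)[OF w] r(2)[OF _ w] by (simp add: c_def)
      finally have "F w (s + 1) = poly p w"
        using \<alpha> by (simp add: p_def poly_sum field_simps)
      then show ?thesis by (simp add: s_def algebra_simps)
    qed
    ultimately show ?case by blast
  qed
qed

section \<open>Scaling\<close>

lemma powr_of_real_times:
  fixes z s :: complex
  assumes "r > 0"
  shows "(of_real r * z) powr s = of_real r powr s * z powr s"
  using assms by (auto simp: powr_def Ln_times_of_real Ln_of_real distrib_left exp_add)

text \<open>Every term of the series is homogeneous of degree \<open>- s\<close>, and the clearing
  factor depends on neither \<open>a\<close> nor \<open>w\<close>.\<close>

lemma barnes_continuation_scale:
  assumes F: "barnes_continuation M a w F" and "\<kappa> > 0"
  shows "barnes_continuation M (\<lambda>j. \<kappa> * a j) (of_real \<kappa> * w) (\<lambda>s. of_real \<kappa> powr (- s) * F s)"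
proof -
  have lin: "lin_comb M (\<lambda>j. \<kappa> * a j) k = \<kappa> * lin_comb M a k" for k
    by (simp add: lin_comb_def sum_distrib_left mult_ac)
  have "barnes_zeta_series M (\<lambda>j. \<kappa> * a j) s (of_real \<kappa> * w) =
          of_real \<kappa> powr (- s) * barnes_zeta_series M a s w" for s
  proof -
    have "(of_real \<kappa> * w + of_real (\<kappa> * lin_comb M a k)) powr (- s) =
            of_real \<kappa> powr (- s) * (w + of_real (lin_comb M a k)) powr (- s)" for k
      using powr_of_real_times[OF \<open>\<kappa> > 0\<close>, of "w + of_real (lin_comb M a k)"]
      by (simp add: distrib_left)
    then show ?thesis
      by (simp add: barnes_zeta_series_eq lin infsum_cmult_right')
  qed
  then have "barnes_cleared M (\<lambda>j. \<kappa> * a j) (of_real \<kappa> * w) s = of_real \<kappa> powr (- s) * barnes_cleared M a w s" for s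
    by (simp add: barnes_cleared_def)
  then show ?thesis
    using assms by (auto simp: barnes_continuation_def intro!: holomorphic_intros)
qed

section \<open>From the cleared function to \<open>barnes_zeta\<close> and its derivative at
  0\<close>

lemma pochhammer_shift_nonzero:
  fixes s :: complex
  assumes "Re s > real M \<or> Re s < 1"
  shows "pochhammer (s - of_nat M) M \<noteq> 0"
proof
  assume "pochhammer (s - of_nat M) M = 0"
  \<comment> \<open>The zeros in \<open>s\<close> are the integers \<open>1, ..., M\<close>.\<close>
  then obtain k where k: "k < M" "s - of_nat M = - of_nat k"
    by (auto simp: pochhammer_eq_0_iff)
  then have "Re s = real M - real k"
    by (simp add: diff_eq_eq)
  then show False using assms k(1) by auto
qed

text \<open>Removing singularities turns the meromorphic quotient into the nicely meromorphic
  representative. On \<open>Re s < 1\<close> the quotient is analytic, so its values there are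
  unchanged.\<close>

lemma barnes_zeta_eq_continuation:
  assumes F: "barnes_continuation M a w F" and s: "Re s < 1"
  shows "barnes_zeta M a s w = F s / pochhammer (s - of_nat M) M"
proof -
  define f where "f s = F s / pochhammer (s - of_nat M) M" for s
  have F': "F holomorphic_on UNIV" "\<And>s. Re s > real M \<Longrightarrow> F s = barnes_cleared M a w s"
    using F by (auto simp: barnes_continuation_def)
  have an: "F analytic_on UNIV" "(\<lambda>s. pochhammer (s - of_nat M) M :: complex) analytic_on UNIV"
    using F' by (auto simp: analytic_on_open intro!: holomorphic_on_pochhammer_compose holomorphic_intros)
  have an_f: "f analytic_on {s}" if "Re s > real M \<or> Re s < 1" for s
    unfolding f_def[abs_def]
    using pochhammer_shift_nonzero[OF that] an
    by (intro analytic_on_divide) (auto intro: analytic_on_subset)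
  have "f meromorphic_on UNIV"
    unfolding f_def[abs_def] using an by (intro meromorphic_intros analytic_on_imp_meromorphic_on)
  then have "remove_sings f nicely_meromorphic_on UNIV"
    by (rule remove_sings_nicely_meromorphic)
  then have "barnes_zeta M a s w = remove_sings f s"
  proof (rule barnes_zeta_eqI)
    fix z :: complex assume z: "Re z > real M"
    then have "remove_sings f z = f z"
      by (intro remove_sings_at_analytic an_f) auto
    also have "\<dots> = barnes_zeta_series M a z w"
      using F'(2)[OF z] pochhammer_shift_nonzero[of M z] z by (simp add: f_def barnes_cleared_def)
    finally show "remove_sings f z = barnes_zeta_series M a z w" .
  qed
  also have "\<dots> = f s"
    using s by (intro remove_sings_at_analytic an_f) auto
  finally show ?thesis by (simp add: f_def)
qed

text \<open>The quotient is holomorphic near 0 and agrees there with \<open>barnes_zeta\<close>, so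
  \<open>deriv\<close> is a genuine derivative.\<close>

lemma barnes_log_gamma_eq_deriv:
  assumes F: "barnes_continuation M a w F" and w: "Re w > 0"
  shows "((\<lambda>s. F s / pochhammer (s - of_nat M) M) has_field_derivative barnes_log_gamma M a w) (at 0)"
proof -
  let ?f = "\<lambda>s. F s / pochhammer (s - of_nat M) M"
  have "F holomorphic_on UNIV"
    using F by (auto simp: barnes_continuation_def)
  then have "?f holomorphic_on {s. Re s < 1}"
    by (intro holomorphic_intros holomorphic_on_pochhammer_compose)
       (auto intro: holomorphic_on_subset dest: pochhammer_shift_nonzero[OF disjI2])
  then have "(?f has_field_derivative deriv ?f 0) (at 0)"
    by (rule holomorphic_derivI) (auto simp: open_halfspace_Re_lt)
  moreover have "deriv ?f 0 = deriv (\<lambda>s. barnes_zeta M a s w) 0"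
  proof (rule deriv_cong_ev)
    have "\<forall>\<^sub>F s in nhds 0. s \<in> {s :: complex. Re s < 1}"
      by (intro eventually_nhds_in_open) (auto simp: open_halfspace_Re_lt)
    then show "\<forall>\<^sub>F s in nhds 0. ?f s = barnes_zeta M a s w"
      by eventually_elim (simp add: barnes_zeta_eq_continuation[OF F])
  qed simp
  ultimately show ?thesis
    using w by (simp add: barnes_log_gamma_def)
qed

text \<open>The product rule for \<open>\<kappa> powr (- s)\<close> times the zeta function at 0
  gives the old derivative minus \<open>ln \<kappa>\<close> times the value at 0, which is
  polynomial in \<open>w\<close>.\<close>

lemma barnes_log_gamma_scale:
  assumes a: "\<And>j. j \<in> {1..M} \<Longrightarrow> a j > 0" and "\<kappa> > 0"
  obtains p where "degree p \<le> M"
    and "\<And>w. Re w > 0 \<Longrightarrow> barnes_log_gamma M (\<lambda>j. \<kappa> * a j) (of_real \<kappa> * w) =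
           barnes_log_gamma M a w - poly p w"
proof -
  have "\<forall>w. \<exists>F. Re w > 0 \<longrightarrow> barnes_continuation M a w F"
    using barnes_continuation_exists[of M a] a by auto
  then obtain F where F: "\<And>w. Re w > 0 \<Longrightarrow> barnes_continuation M a w (F w)"
    by metis
  \<comment> \<open>Taking \<open>j = M\<close> selects the point \<open>s = 0\<close>.\<close>
  obtain q where q: "degree q \<le> M" "\<And>w. Re w > 0 \<Longrightarrow> F w 0 = poly q w"
    using barnes_continuation_polynomial[of M a F M] a F by auto
  define c :: complex where "c = of_real (ln \<kappa>) / pochhammer (- of_nat M) M"
  show ?thesis
  proof
    show "degree (smult c q) \<le> M"
      using q(1) degree_smult_le le_trans by blast
    fix w :: complex assume w: "Re w > 0"
    let ?f = "\<lambda>s. F w s / pochhammer (s - of_nat M) M"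
    have \<kappa>w: "Re (of_real \<kappa> * w) > 0"
      using w \<open>\<kappa> > 0\<close> by simp
    have "((\<lambda>s. of_real \<kappa> powr (- s) * F w s / pochhammer (s - of_nat M) M) has_field_derivative
            barnes_log_gamma M (\<lambda>j. \<kappa> * a j) (of_real \<kappa> * w)) (at 0)"
      by (rule barnes_log_gamma_eq_deriv[OF barnes_continuation_scale[OF F[OF w] \<open>\<kappa> > 0\<close>] \<kappa>w])
    moreover have "((\<lambda>s. of_real \<kappa> powr (- s) * ?f s) has_field_derivative
            - of_real (ln \<kappa>) * ?f 0 + barnes_log_gamma M a w) (at 0)"
    proof -
      have "((\<lambda>s. complex_of_real \<kappa> powr (- s)) has_field_derivative - of_real (ln \<kappa>)) (at 0)"
        using \<open>\<kappa> > 0\<close> by (auto simp: powr_def Ln_of_real intro!: derivative_eq_intros)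
      from DERIV_mult[OF this barnes_log_gamma_eq_deriv[OF F[OF w] w]] show ?thesis
        using \<open>\<kappa> > 0\<close> by (simp add: add.commute mult.commute)
    qed
    ultimately have "barnes_log_gamma M (\<lambda>j. \<kappa> * a j) (of_real \<kappa> * w) =
        - of_real (ln \<kappa>) * ?f 0 + barnes_log_gamma M a w"
      by (simp add: DERIV_unique)
    then show "barnes_log_gamma M (\<lambda>j. \<kappa> * a j) (of_real \<kappa> * w) =
        barnes_log_gamma M a w - poly (smult c q) w"
      using q(2)[OF w] by (simp add: c_def)
  qed
qed

section \<open>Iterated differences of polynomials\<close>

lemma degree_shift_diff:
  fixes p :: "complex poly"
  assumes "degree p \<le> Suc m"
  shows "degree (pcompose p [:c, 1:] - p) \<le> m"
  using assms
proof (induction p arbitrary: m)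
  case 0
  then show ?case by simp
next
  case (pCons a p)
  let ?d = "pcompose p [:c, 1:] - p"
  \<comment> \<open>The two summands are \<open>x * (p (x + c) - p x)\<close> and
    \<open>c * p (x + c)\<close>; only the first needs the induction hypothesis.\<close>
  have eq: "pcompose (pCons a p) [:c, 1:] - pCons a p = pCons 0 ?d + smult c (pcompose p [:c, 1:])"
    by (simp add: pcompose_pCons algebra_simps)
  show ?case
  proof (cases "p = 0")
    case False
    then have deg: "degree p \<le> m" using pCons.prems by simp
    have "degree (pCons 0 ?d) \<le> m"
    proof (cases m)
      \<comment> \<open>Here \<open>p\<close> is constant and the difference is 0; the induction
        hypothesis would need a predecessor of \<open>m\<close>.\<close>
      case 0
      then obtain b where "p = [:b:]" using deg by (auto elim: degree_eq_zeroE)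
      then show ?thesis by simp
    next
      case (Suc m')
      then show ?thesis
        using pCons.IH[of m'] deg by (simp add: degree_pCons_le order.trans[OF degree_pCons_le])
    qed
    moreover have "degree (smult c (pcompose p [:c, 1:])) \<le> m"
      using deg by (simp add: degree_pcompose)
    ultimately show ?thesis
      unfolding eq by (rule degree_add_le)
  qed simp
qed

text \<open>Splitting the subsets by whether they contain \<open>Suc N\<close> turns the sum for
  \<open>p\<close> into the sum over subsets of \<open>{1..N}\<close> for
  \<open>p x - p (x + b (Suc N))\<close>, whose degree bound is lower by one.\<close>

lemma barnes_S_polynomial_degree:
  fixes p :: "complex poly"
  assumes "degree p \<le> m + N"
  shows "\<exists>r. degree r \<le> m \<and>
           (\<forall>x. (\<Sum>J\<in>Pow {1..N}. (-1) ^ card J * poly p (x + of_real (\<Sum>j\<in>J. b j))) = poly r x)"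
  using assms
proof (induction N arbitrary: p)
  case 0
  then show ?case by auto
next
  case (Suc N)
  let ?\<beta> = "complex_of_real (b (Suc N))"
  define q where "q = p - pcompose p [:?\<beta>, 1:]"
  have "degree q \<le> m + N"
    using degree_shift_diff[of p "m + N" ?\<beta>] degree_minus[of q] Suc.prems by (simp add: q_def)
  then obtain r where r: "degree r \<le> m"
      "\<And>x. (\<Sum>J\<in>Pow {1..N}. (-1) ^ card J * poly q (x + of_real (\<Sum>j\<in>J. b j))) = poly r x"
    using Suc.IH by blast
  have "(\<Sum>J\<in>Pow {1..Suc N}. (-1) ^ card J * poly p (x + of_real (\<Sum>j\<in>J. b j))) = poly r x" for x
  proof -
    let ?t = "\<lambda>J. (-1) ^ card J * poly p (x + of_real (\<Sum>j\<in>J. b j))"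
    have notin: "Suc N \<notin> J" if "J \<in> Pow {1..N}" for J
      using that by auto
    have inj: "inj_on (insert (Suc N)) (Pow {1..N})"
      by (rule inj_onI) (metis insert_ident notin)
    have "sum ?t (Pow {1..Suc N}) = sum ?t (Pow {1..N} \<union> insert (Suc N) ` Pow {1..N})"
      by (simp add: atLeastAtMostSuc_conv Pow_insert)
    also have "\<dots> = sum ?t (Pow {1..N}) + sum ?t (insert (Suc N) ` Pow {1..N})"
      by (intro sum.union_disjoint) auto
    also have "sum ?t (insert (Suc N) ` Pow {1..N}) = (\<Sum>J\<in>Pow {1..N}. ?t (insert (Suc N) J))"
      by (rule sum.reindex[unfolded o_def, OF inj])
    also have "\<dots> = (\<Sum>J\<in>Pow {1..N}. - ((-1) ^ card J * poly p (?\<beta> + (x + of_real (\<Sum>j\<in>J. b j)))))"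
    proof (rule sum.cong)
      fix J assume "J \<in> Pow {1..N}"
      then have J: "finite J" "Suc N \<notin> J"
        by (auto intro: finite_subset)
      have "x + of_real (\<Sum>j\<in>insert (Suc N) J. b j) = ?\<beta> + (x + of_real (\<Sum>j\<in>J. b j))"
        using J by simp
      then show "?t (insert (Suc N) J) = - ((-1) ^ card J * poly p (?\<beta> + (x + of_real (\<Sum>j\<in>J. b j))))"
        by (simp only: card_insert_disjoint[OF J] power_Suc mult_minus_left mult_1_left)
    qed simp
    also have "sum ?t (Pow {1..N}) + \<dots> =
        (\<Sum>J\<in>Pow {1..N}. (-1) ^ card J * poly q (x + of_real (\<Sum>j\<in>J. b j)))"
      by (simp add: q_def poly_pcompose sum_negf sum_subtractf right_diff_distrib)
    finally show ?thesis using r(2) by simp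
  qed
  with r(1) show ?case by blast
qed

text \<open>After \<open>N\<close> differences the degree is 0, so the result is constant.\<close>

lemma barnes_S_polynomial:
  fixes p :: "complex poly"
  assumes "degree p \<le> N"
  shows "barnes_S N b (poly p) q = barnes_S N b (poly p) 0"
proof -
  obtain r where r: "degree r = 0"
      "\<And>x. (\<Sum>J\<in>Pow {1..N}. (-1) ^ card J * poly p (x + of_real (\<Sum>j\<in>J. b j))) = poly r x"
    using barnes_S_polynomial_degree[of p 0 N b] assms by auto
  then have "barnes_S N b (poly p) x = coeff r 0" for x
    using r by (auto simp: barnes_S_def elim!: degree_eq_zeroE)
  then show ?thesis by simp
qed

text \<open>All arguments of the log-gamma function have positive real part, so it scales up to a
  polynomial. The polynomial contributes equal constants at \<open>q\<close> and at 0, which cancel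
  in the exponent.\<close>

lemma barnes_eta_scale:
  assumes "M \<le> N" and a: "\<And>j. j \<in> {1..M} \<Longrightarrow> a j > 0" and b: "\<And>j. j \<in> {0..N} \<Longrightarrow> b j > 0"
    and "\<kappa> > 0" and q: "Re q > - b 0"
  shows "barnes_eta M N (\<lambda>j. \<kappa> * a j) (\<lambda>j. \<kappa> * b j) (of_real \<kappa> * q) = barnes_eta M N a b q"
proof -
  obtain p where p: "degree p \<le> M"
    and L: "\<And>w. Re w > 0 \<Longrightarrow> barnes_log_gamma M (\<lambda>j. \<kappa> * a j) (of_real \<kappa> * w) =
                 barnes_log_gamma M a w - poly p w"
    by (rule barnes_log_gamma_scale[of M a \<kappa>]) (use a \<open>\<kappa> > 0\<close> in auto)
  have S: "barnes_S N (\<lambda>j. \<kappa> * b j) (barnes_log_gamma M (\<lambda>j. \<kappa> * a j)) (of_real \<kappa> * x) =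
             barnes_S N b (barnes_log_gamma M a) x - barnes_S N b (poly p) x" if x: "Re x > - b 0" for x
    unfolding barnes_S_def sum_subtractf[symmetric] right_diff_distrib[symmetric]
  proof (intro sum.cong refl arg_cong2[where f = "(*)"])
    fix J assume "J \<in> Pow {1..N}"
    then have "j \<in> {0..N}" if "j \<in> J" for j
      using that by auto
    then have "(\<Sum>j\<in>J. b j) \<ge> 0"
      by (intro sum_nonneg less_imp_le b)
    then have "Re (x + of_real (b 0) + of_real (\<Sum>j\<in>J. b j)) > 0"
      using x by simp
    from L[OF this] show "barnes_log_gamma M (\<lambda>j. \<kappa> * a j)
        (of_real \<kappa> * x + of_real (\<kappa> * b 0) + of_real (\<Sum>j\<in>J. \<kappa> * b j)) =
      barnes_log_gamma M a (x + of_real (b 0) + of_real (\<Sum>j\<in>J. b j)) -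
      poly p (x + of_real (b 0) + of_real (\<Sum>j\<in>J. b j))"
      by (simp add: distrib_left sum_distrib_left)
  qed
  have "b 0 > 0" using b by simp
  then show ?thesis
    using S[OF q] S[of 0] barnes_S_polynomial[of p N b q] p \<open>M \<le> N\<close>
    by (simp add: barnes_eta_def)
qed

section \<open>Uniqueness of the Mellin transform\<close>

text \<open>At \<open>\<i> * t\<close> the Mellin transform is the characteristic function of the
  logarithm. Levy's theorem identifies the laws of the logarithms, and \<open>exp\<close> carries
  them back.\<close>

lemma distr_eq_of_mellin:
  fixes X :: "'p \<Rightarrow> real" and Y :: "'q \<Rightarrow> real"
  assumes P: "prob_space P" and Q: "prob_space Q"
    and X: "X \<in> borel_measurable P" and Y: "Y \<in> borel_measurable Q"
    and X_pos: "AE \<omega> in P. X \<omega> > 0" and Y_pos: "AE \<omega> in Q. Y \<omega> > 0"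
    and eq: "\<And>t :: real. (\<integral>\<omega>. complex_of_real (X \<omega>) powr (\<i> * of_real t) \<partial>P) =
                        (\<integral>\<omega>. complex_of_real (Y \<omega>) powr (\<i> * of_real t) \<partial>Q)"
  shows "distr P borel X = distr Q borel Y"
proof -
  have char: "char (distr R borel (\<lambda>\<omega>. ln (Z \<omega>))) t = (\<integral>\<omega>. complex_of_real (Z \<omega>) powr (\<i> * of_real t) \<partial>R)"
    if "Z \<in> borel_measurable R" "AE \<omega> in R. Z \<omega> > 0" for Z :: "'r \<Rightarrow> real" and R t
  proof -
    have "char (distr R borel (\<lambda>\<omega>. ln (Z \<omega>))) t = (\<integral>\<omega>. iexp (t * ln (Z \<omega>)) \<partial>R)"
      unfolding char_def using that(1) by (intro integral_distr) auto
    also have "\<dots> = (\<integral>\<omega>. complex_of_real (Z \<omega>) powr (\<i> * of_real t) \<partial>R)"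
    proof (rule integral_cong_AE)
      show "AE \<omega> in R. iexp (t * ln (Z \<omega>)) = complex_of_real (Z \<omega>) powr (\<i> * of_real t)"
        using that(2) by eventually_elim (simp add: powr_def Ln_of_real mult_ac)
    qed (use that(1) in \<open>auto simp: powr_def\<close>)
    finally show ?thesis .
  qed
  have exp_ln: "distr (distr R borel (\<lambda>\<omega>. ln (Z \<omega>))) borel exp = distr R borel Z"
    if "Z \<in> borel_measurable R" "AE \<omega> in R. Z \<omega> > 0" for Z :: "'r \<Rightarrow> real" and R
  proof -
    have "distr (distr R borel (\<lambda>\<omega>. ln (Z \<omega>))) borel exp = distr R borel (\<lambda>\<omega>. exp (ln (Z \<omega>)))"
      using that(1) by (subst distr_distr) (auto simp: o_def)
    also have "\<dots> = distr R borel Z"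
    proof (rule distr_cong_AE)
      show "AE \<omega> in R. exp (ln (Z \<omega>)) = Z \<omega>"
        using that(2) by eventually_elim simp
    qed (use that(1) in auto)
    finally show ?thesis .
  qed
  have "distr P borel (\<lambda>\<omega>. ln (X \<omega>)) = distr Q borel (\<lambda>\<omega>. ln (Y \<omega>))"
  proof (rule Levy_uniqueness)
    show "real_distribution (distr P borel (\<lambda>\<omega>. ln (X \<omega>)))"
      using prob_space.prob_space_distr[OF P, of "\<lambda>\<omega>. ln (X \<omega>)" borel] X
      by (simp add: real_distribution_def real_distribution_axioms_def)
    show "real_distribution (distr Q borel (\<lambda>\<omega>. ln (Y \<omega>)))"
      using prob_space.prob_space_distr[OF Q, of "\<lambda>\<omega>. ln (Y \<omega>)" borel] Y
      by (simp add: real_distribution_def real_distribution_axioms_def)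
    show "char (distr P borel (\<lambda>\<omega>. ln (X \<omega>))) = char (distr Q borel (\<lambda>\<omega>. ln (Y \<omega>)))"
      by (rule ext) (simp only: char[OF X X_pos] char[OF Y Y_pos] eq)
  qed
  then show ?thesis
    using exp_ln[OF X X_pos] exp_ln[OF Y Y_pos] by metis
qed

lemma
  assumes "barnes_beta_law M N a b (distr P borel X)" and X: "X \<in> borel_measurable P"
  shows barnes_beta_law_pos: "AE \<omega> in P. X \<omega> > 0"
    and barnes_beta_law_mellin: "Re q > - b 0 \<Longrightarrow>
          (\<integral>\<omega>. complex_of_real (X \<omega>) powr q \<partial>P) = barnes_eta M N a b q"
proof -
  have "AE x in distr P borel X. x \<in> {0<..1}"
    using assms(1) by (simp add: barnes_beta_law_def)
  from AE_distrD[OF X this] show "AE \<omega> in P. X \<omega> > 0"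
    by eventually_elim simp
  show "(\<integral>\<omega>. complex_of_real (X \<omega>) powr q \<partial>P) = barnes_eta M N a b q" if "Re q > - b 0"
  proof -
    have "(\<integral>x. complex_of_real x powr q \<partial>distr P borel X) = barnes_eta M N a b q"
      using assms(1) that by (simp add: barnes_beta_law_def has_bochner_integral_integral_eq)
    moreover have "(\<integral>x. complex_of_real x powr q \<partial>distr P borel X) =
                   (\<integral>\<omega>. complex_of_real (X \<omega>) powr q \<partial>P)"
      using X by (intro integral_distr) (auto simp: powr_def)
    ultimately show ?thesis by simp
  qed
qed

theorem theorem4p2:
  fixes M N :: nat and a b :: "nat \<Rightarrow> real" and \<kappa> :: real
    and P :: "'p measure" and X :: "'p \<Rightarrow> real"
    and Q :: "'q measure" and Y :: "'q \<Rightarrow> real"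
  assumes "M \<le> N"
    and "\<And>j. j \<in> {1..M} \<Longrightarrow> a j > 0"
    and "\<And>j. j \<in> {0..N} \<Longrightarrow> b j > 0"
    and "\<kappa> > 0"
    and "prob_space P" and "X \<in> borel_measurable P"
    and "barnes_beta_law M N (\<lambda>j. \<kappa> * a j) (\<lambda>j. \<kappa> * b j) (distr P borel X)"
    and "prob_space Q" and "Y \<in> borel_measurable Q"
    and "barnes_beta_law M N a b (distr Q borel Y)"
  shows "distr P borel (\<lambda>\<omega>. X \<omega> powr \<kappa>) = distr Q borel Y"
proof (rule distr_eq_of_mellin)
  have "b 0 > 0" using assms(3) by simp
  have X_pos: "AE \<omega> in P. X \<omega> > 0"
    by (rule barnes_beta_law_pos[OF assms(7,6)])
  then show "AE \<omega> in P. X \<omega> powr \<kappa> > 0"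
    by eventually_elim simp
  show "AE \<omega> in Q. Y \<omega> > 0"
    by (rule barnes_beta_law_pos[OF assms(10,9)])
  fix t :: real
  \<comment> \<open>Where \<open>X > 0\<close> the exponents multiply: the transform of the power at
    \<open>\<i> * t\<close> is that of \<open>X\<close> at \<open>\<kappa> * \<i> * t\<close>, which
    also has real part 0.\<close>
  have "(\<integral>\<omega>. complex_of_real (X \<omega> powr \<kappa>) powr (\<i> * of_real t) \<partial>P) =
        (\<integral>\<omega>. complex_of_real (X \<omega>) powr (of_real \<kappa> * (\<i> * of_real t)) \<partial>P)"
  proof (rule integral_cong_AE)
    show "AE \<omega> in P. complex_of_real (X \<omega> powr \<kappa>) powr (\<i> * of_real t) =
            complex_of_real (X \<omega>) powr (of_real \<kappa> * (\<i> * of_real t))"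
      using X_pos by eventually_elim (simp add: powr_def Ln_of_real mult_ac)
  qed (use assms(6) in \<open>auto simp: powr_def\<close>)
  also have "\<dots> = barnes_eta M N (\<lambda>j. \<kappa> * a j) (\<lambda>j. \<kappa> * b j) (of_real \<kappa> * (\<i> * of_real t))"
    by (rule barnes_beta_law_mellin[OF assms(7,6)]) (use \<open>b 0 > 0\<close> assms(4) in simp)
  also have "\<dots> = barnes_eta M N a b (\<i> * of_real t)"
    by (rule barnes_eta_scale) (use assms \<open>b 0 > 0\<close> in auto)
  also have "\<dots> = (\<integral>\<omega>. complex_of_real (Y \<omega>) powr (\<i> * of_real t) \<partial>Q)"
    by (rule barnes_beta_law_mellin[OF assms(10,9), symmetric]) (use \<open>b 0 > 0\<close> in simp)
  finally show "(\<integral>\<omega>. complex_of_real (X \<omega> powr \<kappa>) powr (\<i> * of_real t) \<partial>P) =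
    (\<integral>\<omega>. complex_of_real (Y \<omega>) powr (\<i> * of_real t) \<partial>Q)" .
qed (use assms in auto)

end
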